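(* The sequent calculus $\mathsf{IcRL}$ admits cut-elimination; that is, there is an algorithm that transforms any derivation of a sequent in $\mathsf{IcRL}$ into a derivation of the same sequent in $\mathsf{IcRL}$ that does not use the cut rule.
   Context: Residuated lattice terms are built from a fixed countably infinite set of variables using binary $\wedge,\vee,\cdot,\backslash,/$ and the constant $\mathrm{e}$. A residuated lattice is an algebra $\langle A,\wedge,\vee,\cdot,\backslash,/,\mathrm{e}\rangle$ with $\langle A,\wedge,\vee\rangle$ a lattice, $\langle A,\cdot,\mathrm{e}\rangle$ a monoid, and $b\le a\backslash c\iff ab\le c\iff a\le c/b$ for all $a,b,c$. $\mathcal{LG}$ is the variety of lattice-ordered groups, identified with residuated lattices satisfying $x(x\backslash\mathrm{e})\approx\mathrm{e}$. A (single-conclusion) sequent is an expression $\Gamma\Rightarrow t$ where $\Gamma$ is a finite, possibly empty, sequence of terms and $t$ is a term; $s_1,\dots,s_n\Rightarrow t$ is valid in a class $\mathcal{K}$ of residuated lattices, written $\models_{\mathcal{K}}s_1,\dots,s_n\Rightarrow t$, if $\mathcal{K}\models s_1\cdots s_n\le t$ (the empty product is $\mathrm{e}$). The calculus $\mathsf{IcRL}$ has the following rules (Greek capitals denote arbitrary finite sequences of terms, $s,t,u$ arbitrary terms). Identity: $s\Rightarrow s$. Cut: from $\Gamma_2\Rightarrow s$ and $\Gamma_1,s,\Gamma_3\Rightarrow u$ infer $\Gamma_1,\Gamma_2,\Gamma_3\Rightarrow u$. $(\mathrm{e}\Rightarrow)$: from $\Gamma_1,\Gamma_2\Rightarrow u$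 infer $\Gamma_1,\mathrm{e},\Gamma_2\Rightarrow u$. $(\Rightarrow\mathrm{e})$: axiom $\Rightarrow\mathrm{e}$. $(/\Rightarrow)$: from $\Gamma_2\Rightarrow s$ and $\Gamma_1,t,\Gamma_3\Rightarrow u$ infer $\Gamma_1,t/s,\Gamma_2,\Gamma_3\Rightarrow u$. $(\Rightarrow/)$: from $\Gamma,s\Rightarrow t$ infer $\Gamma\Rightarrow t/s$. $(\backslash\Rightarrow)$: from $\Gamma_2\Rightarrow s$ and $\Gamma_1,t,\Gamma_3\Rightarrow u$ infer $\Gamma_1,\Gamma_2,s\backslash t,\Gamma_3\Rightarrow u$. $(\Rightarrow\backslash)$: from $s,\Gamma\Rightarrow t$ infer $\Gamma\Rightarrow s\backslash t$. $(\cdot\Rightarrow)$: from $\Gamma_1,s,t,\Gamma_2\Rightarrow u$ infer $\Gamma_1,s\cdot t,\Gamma_2\Rightarrow u$. $(\Rightarrow\cdot)$: from $\Gamma_1\Rightarrow s$ and $\Gamma_2\Rightarrow t$ infer $\Gamma_1,\Gamma_2\Rightarrow s\cdot t$. $(\wedge\Rightarrow)_1$, $(\wedge\Rightarrow)_2$: from $\Gamma_1,s,\Gamma_2\Rightarrow u$ (respectively $\Gamma_1,t,\Gamma_2\Rightarrow u$) infer $\Gamma_1,s\wedge t,\Gamma_2\Rightarrow u$. $(\Rightarrow\wedge)$: from $\Gamma\Rightarrow s$ and $\Gamma\Rightarrow t$ infer $\Gamma\Rightarrow s\wedge t$. $(\vee\Rightarrow)$: from $\Gamma_1,s,\Gamma_2\Rightarrow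 u$ and $\Gamma_1,t,\Gamma_2\Rightarrow u$ infer $\Gamma_1,s\vee t,\Gamma_2\Rightarrow u$. $(\Rightarrow\vee)_1$, $(\Rightarrow\vee)_2$: from $\Gamma\Rightarrow s$ (respectively $\Gamma\Rightarrow t$) infer $\Gamma\Rightarrow s\vee t$. $(\mathcal{LG}\text{-w})$: from $\Gamma,\Pi\Rightarrow u$ infer $\Gamma,\Delta,\Pi\Rightarrow u$, provided that $\models_{\mathcal{LG}}\Delta\Rightarrow\mathrm{e}$ (a side-condition). *)

theory Defs
  imports "HOL-Algebra.Group" "HOL-Library.Nat_Bijection" "HOL-Library.Countable_Set"
begin

section \<open>Terms, residuated lattices, lattice-ordered groups\<close>

text \<open>In \<open>LDiv s t\<close> (written \<open>s\t\<close> in the literature) and \<open>RDiv t s\<close> (written \<open>t/s\<close>),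
  the denominator is \<open>s\<close>.\<close>

datatype tm = Var nat | Unit
  | Meet tm tm | Join tm tm | Mult tm tm | LDiv tm tm | RDiv tm tm

record 'a rl_algebra = "'a monoid" +
  rl_meet :: "'a \<Rightarrow> 'a \<Rightarrow> 'a"
  rl_join :: "'a \<Rightarrow> 'a \<Rightarrow> 'a"
  rl_ldiv :: "'a \<Rightarrow> 'a \<Rightarrow> 'a"
  rl_rdiv :: "'a \<Rightarrow> 'a \<Rightarrow> 'a"

definition rl_le :: "('a, 'b) rl_algebra_scheme \<Rightarrow> 'a \<Rightarrow> 'a \<Rightarrow> bool" where
  "rl_le A a b \<longleftrightarrow> rl_meet A a b = a"

locale residuated_lattice = monoid A for A :: "'a rl_algebra" +
  assumes meet_closed: "a \<in> carrier A \<Longrightarrow> b \<in> carrier A \<Longrightarrow> rl_meet A a b \<in> carrier A"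
    and join_closed: "a \<in> carrier A \<Longrightarrow> b \<in> carrier A \<Longrightarrow> rl_join A a b \<in> carrier A"
    and ldiv_closed: "a \<in> carrier A \<Longrightarrow> b \<in> carrier A \<Longrightarrow> rl_ldiv A a b \<in> carrier A"
    and rdiv_closed: "a \<in> carrier A \<Longrightarrow> b \<in> carrier A \<Longrightarrow> rl_rdiv A a b \<in> carrier A"
    and meet_commute: "a \<in> carrier A \<Longrightarrow> b \<in> carrier A \<Longrightarrow> rl_meet A a b = rl_meet A b a"
    and join_commute: "a \<in> carrier A \<Longrightarrow> b \<in> carrier A \<Longrightarrow> rl_join A a b = rl_join A b a"
    and meet_assoc: "a \<in> carrier A \<Longrightarrow> b \<in> carrier A \<Longrightarrow> c \<in> carrier A \<Longrightarrow>
      rl_meet A (rl_meet A a b) c = rl_meet A a (rl_meet A b c)"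
    and join_assoc: "a \<in> carrier A \<Longrightarrow> b \<in> carrier A \<Longrightarrow> c \<in> carrier A \<Longrightarrow>
      rl_join A (rl_join A a b) c = rl_join A a (rl_join A b c)"
    and meet_absorb: "a \<in> carrier A \<Longrightarrow> b \<in> carrier A \<Longrightarrow> rl_meet A a (rl_join A a b) = a"
    and join_absorb: "a \<in> carrier A \<Longrightarrow> b \<in> carrier A \<Longrightarrow> rl_join A a (rl_meet A a b) = a"
    and ldiv_residual: "a \<in> carrier A \<Longrightarrow> b \<in> carrier A \<Longrightarrow> c \<in> carrier A \<Longrightarrow>
      rl_le A b (rl_ldiv A a c) \<longleftrightarrow> rl_le A (a \<otimes>\<^bsub>A\<^esub> b) c"
    and rdiv_residual: "a \<in> carrier A \<Longrightarrow> b \<in> carrier A \<Longrightarrow> c \<in> carrier A \<Longrightarrow>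
      rl_le A a (rl_rdiv A c b) \<longleftrightarrow> rl_le A (a \<otimes>\<^bsub>A\<^esub> b) c"

locale l_group = residuated_lattice +
  assumes mult_ldiv_one: "a \<in> carrier A \<Longrightarrow> a \<otimes>\<^bsub>A\<^esub> rl_ldiv A a \<one>\<^bsub>A\<^esub> = \<one>\<^bsub>A\<^esub>"

primrec tm_eval :: "'a rl_algebra \<Rightarrow> (nat \<Rightarrow> 'a) \<Rightarrow> tm \<Rightarrow> 'a" where
  "tm_eval A v (Var i) = v i"
| "tm_eval A v Unit = \<one>\<^bsub>A\<^esub>"
| "tm_eval A v (Meet s t) = rl_meet A (tm_eval A v s) (tm_eval A v t)"
| "tm_eval A v (Join s t) = rl_join A (tm_eval A v s) (tm_eval A v t)"
| "tm_eval A v (Mult s t) = tm_eval A v s \<otimes>\<^bsub>A\<^esub> tm_eval A v t"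
| "tm_eval A v (LDiv s t) = rl_ldiv A (tm_eval A v s) (tm_eval A v t)"
| "tm_eval A v (RDiv t s) = rl_rdiv A (tm_eval A v t) (tm_eval A v s)"

definition seq_eval :: "'a rl_algebra \<Rightarrow> (nat \<Rightarrow> 'a) \<Rightarrow> tm list \<Rightarrow> 'a" where
  "seq_eval A v \<Gamma> = foldr (\<lambda>s a. tm_eval A v s \<otimes>\<^bsub>A\<^esub> a) \<Gamma> \<one>\<^bsub>A\<^esub>"

datatype sequent = Sequent (antecedent: "tm list") (succedent: tm)  (infix "\<turnstile>" 50)

definition holds_in :: "'a rl_algebra \<Rightarrow> sequent \<Rightarrow> bool" where
  "holds_in A S \<longleftrightarrow> (\<forall>v. range v \<subseteq> carrier A \<longrightarrow>
     rl_le A (seq_eval A v (antecedent S)) (tm_eval A v (succedent S)))"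

text \<open>Validity in the variety of all lattice-ordered groups. One cannot quantify over all
  types, but as a sequent that fails in some lattice-ordered group already fails in a
  countable subalgebra, carriers consisting of natural numbers suffice; see \<open>LG_valid_iff\<close>
  and \<open>LG_valid_holds_in\<close> below.\<close>

definition LG_valid :: "sequent \<Rightarrow> bool" where
  "LG_valid S \<longleftrightarrow> (\<forall>A :: nat rl_algebra. l_group A \<longrightarrow> holds_in A S)"

lemma tm_eval_closed:
  assumes "residuated_lattice A" and "range v \<subseteq> carrier A"
  shows "tm_eval A v t \<in> carrier A"
proof -
  interpret residuated_lattice A by fact
  show ?thesis
    using assms(2)
    by (induction t) (auto simp: meet_closed join_closed ldiv_closed rdiv_closed)
qed

lemma seq_eval_closed:
  assumes "residuated_lattice A" and "range v \<subseteq> carrier A"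
  shows "seq_eval A v \<Gamma> \<in> carrier A"
proof -
  interpret residuated_lattice A by fact
  show ?thesis
    using tm_eval_closed[OF assms] by (induction \<Gamma>) (auto simp: seq_eval_def)
qed

instance tm :: countable
  by countable_datatype

text \<open>Transporting the subalgebra generated by a valuation along an injection.\<close>

lemma holds_in_transport:
  fixes A :: "'a rl_algebra" and c :: "'a \<Rightarrow> 'b"
  assumes lg: "l_group A" and v: "range v \<subseteq> carrier A"
    and inj: "inj_on c (range (tm_eval A v))"
    and hold: "\<And>A' :: 'b rl_algebra. l_group A' \<Longrightarrow> holds_in A' S"
  shows "rl_le A (seq_eval A v (antecedent S)) (tm_eval A v (succedent S))"
proof -
  interpret l_group A by fact
  have rl: "residuated_lattice A" ..
  define B where "B = range (tm_eval A v)"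
  define d where "d = inv_into B c"
  have dc: "d (c x) = x" if "x \<in> B" for x
    using that inj by (simp add: d_def B_def)
  have BA: "x \<in> carrier A" if "x \<in> B" for x
    using that tm_eval_closed[OF rl v] by (auto simp: B_def)
  have B1: "\<one>\<^bsub>A\<^esub> \<in> B"
    unfolding B_def by (rule range_eqI[where x = Unit]) simp
  have Bm: "rl_meet A x y \<in> B" if "x \<in> B" "y \<in> B" for x y
    using that by (auto simp: B_def simp flip: tm_eval.simps(3))
  have Bj: "rl_join A x y \<in> B" if "x \<in> B" "y \<in> B" for x y
    using that by (auto simp: B_def simp flip: tm_eval.simps(4))
  have Bt: "x \<otimes>\<^bsub>A\<^esub> y \<in> B" if "x \<in> B" "y \<in> B" for x y
    using that by (auto simp: B_def simp flip: tm_eval.simps(5))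
  have Bl: "rl_ldiv A x y \<in> B" if "x \<in> B" "y \<in> B" for x y
    using that by (auto simp: B_def simp flip: tm_eval.simps(6))
  have Br: "rl_rdiv A x y \<in> B" if "x \<in> B" "y \<in> B" for x y
    using that by (auto simp: B_def simp flip: tm_eval.simps(7))
  note Bs = B1 Bm Bj Bt Bl Br
  have cinj: "c x = c y \<longleftrightarrow> x = y" if "x \<in> B" "y \<in> B" for x y
    using that inj unfolding B_def by (meson inj_on_eq_iff)
  define A' :: "'b rl_algebra" where "A' =
    \<lparr>carrier = c ` B, mult = (\<lambda>x y. c (d x \<otimes>\<^bsub>A\<^esub> d y)), one = c \<one>\<^bsub>A\<^esub>,
     rl_meet = (\<lambda>x y. c (rl_meet A (d x) (d y))), rl_join = (\<lambda>x y. c (rl_join A (d x) (d y))),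
     rl_ldiv = (\<lambda>x y. c (rl_ldiv A (d x) (d y))), rl_rdiv = (\<lambda>x y. c (rl_rdiv A (d x) (d y)))\<rparr>"
  have sel: "carrier A' = c ` B" "\<one>\<^bsub>A'\<^esub> = c \<one>\<^bsub>A\<^esub>"
    "\<And>x y. x \<otimes>\<^bsub>A'\<^esub> y = c (d x \<otimes>\<^bsub>A\<^esub> d y)"
    "\<And>x y. rl_meet A' x y = c (rl_meet A (d x) (d y))" "\<And>x y. rl_join A' x y = c (rl_join A (d x) (d y))"
    "\<And>x y. rl_ldiv A' x y = c (rl_ldiv A (d x) (d y))" "\<And>x y. rl_rdiv A' x y = c (rl_rdiv A (d x) (d y))"
    by (simp_all add: A'_def)
  have le: "rl_le A' (c x) (c y) \<longleftrightarrow> rl_le A x y" if "x \<in> B" "y \<in> B" for x y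
    using that by (simp add: rl_le_def sel dc Bs cinj)
  have "l_group A'"
  proof unfold_locales
    show "rl_le A' b (rl_ldiv A' a x) \<longleftrightarrow> rl_le A' (a \<otimes>\<^bsub>A'\<^esub> b) x"
      if "a \<in> carrier A'" "b \<in> carrier A'" "x \<in> carrier A'" for a b x
      using that by (auto simp: sel(1,3,6) dc le Bs ldiv_residual BA)
    show "rl_le A' a (rl_rdiv A' x b) \<longleftrightarrow> rl_le A' (a \<otimes>\<^bsub>A'\<^esub> b) x"
      if "a \<in> carrier A'" "b \<in> carrier A'" "x \<in> carrier A'" for a b x
      using that by (auto simp: sel(1,3,7) dc le Bs rdiv_residual BA)
    show "rl_meet A' a b = rl_meet A' b a" if "a \<in> carrier A'" "b \<in> carrier A'" for a b
      using that by (auto simp: sel dc intro!: arg_cong[where f = c] meet_commute BA)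
    show "rl_join A' a b = rl_join A' b a" if "a \<in> carrier A'" "b \<in> carrier A'" for a b
      using that by (auto simp: sel dc intro!: arg_cong[where f = c] join_commute BA)
  qed (auto simp: sel dc Bs BA m_assoc meet_assoc join_assoc meet_absorb join_absorb mult_ldiv_one)
  moreover have "range (c \<circ> v) \<subseteq> carrier A'"
  proof -
    have "v i \<in> B" for i
      unfolding B_def by (rule range_eqI[where x = "Var i"]) simp
    then show ?thesis by (auto simp: sel)
  qed
  ultimately have "rl_le A' (seq_eval A' (c \<circ> v) (antecedent S)) (tm_eval A' (c \<circ> v) (succedent S))"
    using hold by (simp add: holds_in_def)
  moreover have tB: "tm_eval A v t \<in> B" for t
    by (simp add: B_def)
  moreover have teq: "tm_eval A' (c \<circ> v) t = c (tm_eval A v t)" for t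
    by (induction t) (simp_all add: sel dc tB)
  moreover have sB: "seq_eval A v \<Gamma> \<in> B" for \<Gamma>
    by (induction \<Gamma>) (auto simp: seq_eval_def Bs tB)
  moreover have "seq_eval A' (c \<circ> v) \<Gamma> = c (seq_eval A v \<Gamma>)" for \<Gamma>
  proof (induction \<Gamma>)
    case (Cons s \<Gamma>)
    then show ?case
      using sB[of \<Gamma>] by (simp add: seq_eval_def sel(2,3) teq[unfolded comp_def] comp_def dc tB)
  qed (simp add: seq_eval_def sel)
  ultimately show ?thesis
    by (simp add: le)
qed

lemma LG_valid_holds_in:
  fixes A :: "'a rl_algebra"
  assumes "LG_valid S" and "l_group A"
  shows "holds_in A S"
  unfolding holds_in_def
proof (intro allI impI)
  fix v :: "nat \<Rightarrow> 'a" assume "range v \<subseteq> carrier A"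
  moreover have "inj_on (to_nat_on (range (tm_eval A v))) (range (tm_eval A v))"
    by (intro inj_on_to_nat_on countable_image) simp
  ultimately show "rl_le A (seq_eval A v (antecedent S)) (tm_eval A v (succedent S))"
    using assms by (intro holds_in_transport) (auto simp: LG_valid_def)
qed

lemma LG_valid_iff:
  assumes "infinite (UNIV :: 'a set)"
  shows "LG_valid S \<longleftrightarrow> (\<forall>A :: 'a rl_algebra. l_group A \<longrightarrow> holds_in A S)"
proof
  assume *: "\<forall>A :: 'a rl_algebra. l_group A \<longrightarrow> holds_in A S"
  obtain c :: "nat \<Rightarrow> 'a" where "inj c"
    using assms infinite_countable_subset by blast
  then have "inj_on c X" for X
    by (rule inj_on_subset) simp
  then show "LG_valid S"
    unfolding LG_valid_def holds_in_def[of "_ :: nat rl_algebra"]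
    using * by (intro allI impI holds_in_transport[where c = c]) auto
qed (simp add: LG_valid_holds_in)


section \<open>The calculus\<close>

datatype rule =
    Ident | Cut
  | UnitL | UnitR
  | RDivL | RDivR | LDivL | LDivR
  | MultL | MultR
  | MeetL1 | MeetL2 | MeetR
  | JoinL | JoinR1 | JoinR2
  | LGWeak

text \<open>\<open>rule_instance r Ps S\<close>: the sequent \<open>S\<close> follows from the list of premises \<open>Ps\<close> by an
  instance of the rule \<open>r\<close>.\<close>

inductive rule_instance :: "rule \<Rightarrow> sequent list \<Rightarrow> sequent \<Rightarrow> bool" where
  "rule_instance Ident [] ([s] \<turnstile> s)"
| "rule_instance Cut [\<Gamma>2 \<turnstile> s, \<Gamma>1 @ [s] @ \<Gamma>3 \<turnstile> u] (\<Gamma>1 @ \<Gamma>2 @ \<Gamma>3 \<turnstile> u)"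
| "rule_instance UnitL [\<Gamma>1 @ \<Gamma>2 \<turnstile> u] (\<Gamma>1 @ [Unit] @ \<Gamma>2 \<turnstile> u)"
| "rule_instance UnitR [] ([] \<turnstile> Unit)"
| "rule_instance RDivL [\<Gamma>2 \<turnstile> s, \<Gamma>1 @ [t] @ \<Gamma>3 \<turnstile> u] (\<Gamma>1 @ [RDiv t s] @ \<Gamma>2 @ \<Gamma>3 \<turnstile> u)"
| "rule_instance RDivR [\<Gamma> @ [s] \<turnstile> t] (\<Gamma> \<turnstile> RDiv t s)"
| "rule_instance LDivL [\<Gamma>2 \<turnstile> s, \<Gamma>1 @ [t] @ \<Gamma>3 \<turnstile> u] (\<Gamma>1 @ \<Gamma>2 @ [LDiv s t] @ \<Gamma>3 \<turnstile> u)"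
| "rule_instance LDivR [[s] @ \<Gamma> \<turnstile> t] (\<Gamma> \<turnstile> LDiv s t)"
| "rule_instance MultL [\<Gamma>1 @ [s, t] @ \<Gamma>2 \<turnstile> u] (\<Gamma>1 @ [Mult s t] @ \<Gamma>2 \<turnstile> u)"
| "rule_instance MultR [\<Gamma>1 \<turnstile> s, \<Gamma>2 \<turnstile> t] (\<Gamma>1 @ \<Gamma>2 \<turnstile> Mult s t)"
| "rule_instance MeetL1 [\<Gamma>1 @ [s] @ \<Gamma>2 \<turnstile> u] (\<Gamma>1 @ [Meet s t] @ \<Gamma>2 \<turnstile> u)"
| "rule_instance MeetL2 [\<Gamma>1 @ [t] @ \<Gamma>2 \<turnstile> u] (\<Gamma>1 @ [Meet s t] @ \<Gamma>2 \<turnstile> u)"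
| "rule_instance MeetR [\<Gamma> \<turnstile> s, \<Gamma> \<turnstile> t] (\<Gamma> \<turnstile> Meet s t)"
| "rule_instance JoinL [\<Gamma>1 @ [s] @ \<Gamma>2 \<turnstile> u, \<Gamma>1 @ [t] @ \<Gamma>2 \<turnstile> u] (\<Gamma>1 @ [Join s t] @ \<Gamma>2 \<turnstile> u)"
| "rule_instance JoinR1 [\<Gamma> \<turnstile> s] (\<Gamma> \<turnstile> Join s t)"
| "rule_instance JoinR2 [\<Gamma> \<turnstile> t] (\<Gamma> \<turnstile> Join s t)"
| "LG_valid (\<Delta> \<turnstile> Unit) \<Longrightarrow> rule_instance LGWeak [\<Gamma> @ \<Theta> \<turnstile> u] (\<Gamma> @ \<Delta> @ \<Theta> \<turnstile> u)"

text \<open>Trees whose nodes carry a sequent and a rule label; \<open>is_derivation\<close> singles out those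
  that are derivations in \<open>IcRL\<close>.\<close>

datatype deriv = Infer (last_rule: rule) (subderivs: "deriv list") (conclusion: sequent)

fun is_derivation :: "deriv \<Rightarrow> bool" where
  "is_derivation (Infer r ds S) \<longleftrightarrow>
     rule_instance r (map conclusion ds) S \<and> (\<forall>d \<in> set ds. is_derivation d)"

fun cut_free :: "deriv \<Rightarrow> bool" where
  "cut_free (Infer r ds S) \<longleftrightarrow> r \<noteq> Cut \<and> (\<forall>d \<in> set ds. cut_free d)"


section \<open>Algorithms\<close>

text \<open>Kleene's partial recursive functions, as programs with a big-step semantics:
  \<open>recf_eval p xs y\<close> means that \<open>p\<close> halts on the argument list \<open>xs\<close> with result \<open>y\<close>.
  In \<open>Prec\<close> and \<open>Mu\<close> the recursion variable, respectively the variable searched over, is the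
  first argument.\<close>

datatype recf = Zero | Succ | Proj nat | Comp recf "recf list" | Prec recf recf | Mu recf

inductive recf_eval :: "recf \<Rightarrow> nat list \<Rightarrow> nat \<Rightarrow> bool" where
  eval_Zero: "recf_eval Zero xs 0"
| eval_Succ: "recf_eval Succ [x] (Suc x)"
| eval_Proj: "i < length xs \<Longrightarrow> recf_eval (Proj i) xs (xs ! i)"
| eval_Comp: "list_all2 (\<lambda>g y. recf_eval g xs y) gs ys \<Longrightarrow> recf_eval f ys z \<Longrightarrow>
    recf_eval (Comp f gs) xs z"
| eval_Prec_0: "recf_eval f xs y \<Longrightarrow> recf_eval (Prec f g) (0 # xs) y"
| eval_Prec_Suc: "recf_eval (Prec f g) (n # xs) y \<Longrightarrow> recf_eval g (n # y # xs) z \<Longrightarrow>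
    recf_eval (Prec f g) (Suc n # xs) z"
| eval_Mu: "recf_eval f (n # xs) 0 \<Longrightarrow> (\<And>m. m < n \<Longrightarrow> \<exists>k. recf_eval f (m # xs) (Suc k)) \<Longrightarrow>
    recf_eval (Mu f) xs n"

lemma recf_eval_deterministic:
  "recf_eval p xs y \<Longrightarrow> recf_eval p xs z \<Longrightarrow> y = z"
proof (induction arbitrary: z rule: recf_eval.induct)
  case (eval_Comp xs gs ys f y)
  from eval_Comp.prems obtain ys'
    where ys': "list_all2 (\<lambda>g. recf_eval g xs) gs ys'" and z: "recf_eval f ys' z"
    by (auto elim: recf_eval.cases)
  have "ys = ys'"
    using eval_Comp.IH(1) ys'
    by (intro nth_equalityI) (auto simp: list_all2_conv_all_nth)
  with z eval_Comp.IH(2) show ?case by blast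
next
  case (eval_Prec_0 f xs y g)
  from eval_Prec_0.prems show ?case
    by cases (use eval_Prec_0.IH in auto)
next
  case (eval_Prec_Suc f g n xs y w)
  from eval_Prec_Suc.prems show ?case
    by cases (use eval_Prec_Suc.IH in blast)
next
  case (eval_Mu f n xs)
  from eval_Mu.prems show ?case
  proof cases
    case eval_Mu': eval_Mu
    show ?thesis
    proof (cases n z rule: linorder_cases)
      case less
      with eval_Mu'(2) obtain k where "recf_eval f (n # xs) (Suc k)" by blast
      with eval_Mu.IH(1) show ?thesis by blast
    next
      case greater
      with eval_Mu.IH(2) eval_Mu'(1) show ?thesis by blast
    qed
  qed
qed (auto elim: recf_eval.cases)

text \<open>Goedel numbers of derivations, built from the standard bijective codings of pairs
  and of lists by natural numbers.\<close>

primrec tm_code :: "tm \<Rightarrow> nat" where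
  "tm_code (Var i) = prod_encode (0, i)"
| "tm_code Unit = prod_encode (1, 0)"
| "tm_code (Meet s t) = prod_encode (2, prod_encode (tm_code s, tm_code t))"
| "tm_code (Join s t) = prod_encode (3, prod_encode (tm_code s, tm_code t))"
| "tm_code (Mult s t) = prod_encode (4, prod_encode (tm_code s, tm_code t))"
| "tm_code (LDiv s t) = prod_encode (5, prod_encode (tm_code s, tm_code t))"
| "tm_code (RDiv s t) = prod_encode (6, prod_encode (tm_code s, tm_code t))"

definition sequent_code :: "sequent \<Rightarrow> nat" where
  "sequent_code S =
     prod_encode (list_encode (map tm_code (antecedent S)), tm_code (succedent S))"

primrec rule_code :: "rule \<Rightarrow> nat" where
  "rule_code Ident = 0"
| "rule_code Cut = 1"
| "rule_code UnitL = 2"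
| "rule_code UnitR = 3"
| "rule_code RDivL = 4"
| "rule_code RDivR = 5"
| "rule_code LDivL = 6"
| "rule_code LDivR = 7"
| "rule_code MultL = 8"
| "rule_code MultR = 9"
| "rule_code MeetL1 = 10"
| "rule_code MeetL2 = 11"
| "rule_code MeetR = 12"
| "rule_code JoinL = 13"
| "rule_code JoinR1 = 14"
| "rule_code JoinR2 = 15"
| "rule_code LGWeak = 16"

primrec deriv_code :: "deriv \<Rightarrow> nat" where
  "deriv_code (Infer r ds S) =
     prod_encode (rule_code r, prod_encode (list_encode (map deriv_code ds), sequent_code S))"

lemma inj_tm_code: "inj tm_code"
proof (rule injI)
  show "s = t" if "tm_code s = tm_code t" for s t
    using that by (induction s arbitrary: t) (case_tac t; simp)+
qed

lemma inj_sequent_code: "inj sequent_code"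
  by (rule injI, rename_tac S T, case_tac S, case_tac T)
    (auto simp: sequent_code_def list_encode_eq inj_map_eq_map[OF inj_tm_code]
      dest: injD[OF inj_tm_code])

lemma inj_rule_code: "inj rule_code"
  by (rule injI, rename_tac r r', case_tac r; case_tac r') simp_all

lemma inj_deriv_code: "inj deriv_code"
proof (rule injI)
  show "d = d'" if "deriv_code d = deriv_code d'" for d d'
    using that
  proof (induction d arbitrary: d')
    case (Infer r ds S)
    obtain r' ds' S' where d': "d' = Infer r' ds' S'" by (cases d')
    from Infer.prems have *: "map deriv_code ds = map deriv_code ds'" "r = r'" "S = S'"
      by (auto simp: d' list_encode_eq dest: injD[OF inj_rule_code] injD[OF inj_sequent_code])
    then have "length ds = length ds'"
      by (metis length_map)
    moreover have "ds ! i = ds' ! i" if "i < length ds" for i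
      using that Infer.IH *(1) calculation by (metis nth_map nth_mem)
    ultimately have "ds = ds'"
      by (rule nth_equalityI)
    with * show ?case by (simp add: d')
  qed
qed

end

theory Submission
  imports Defs
begin

text \<open>The algorithm is an unbounded search for a cut-free derivation, and the point is to make the
  target of the search recursively enumerable without a decision procedure for lattice-ordered groups.
  Given a derivation \<open>d\<close>, let \<open>V\<close> be the finite set of sequences \<open>\<Delta>\<close> inserted by the weakening steps of
  \<open>d\<close>, and let \<open>V*\<close> be the set of those \<open>\<Delta>\<close> for which \<open>\<Delta> \<Rightarrow> e\<close> has a derivation, possibly with cuts,
  whose weakening steps insert only members of \<open>V\<close>. By soundness all members of \<open>V*\<close> are valid.
  As \<open>V*\<close> is closed under cutting a formula of \<open>\<Delta>\<close> against a sequent derivable from \<open>V*\<close>, the usual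
  cut-elimination argument turns \<open>d\<close> into a cut-free derivation that weakens only by members of \<open>V*\<close>,
  and such derivations, being certified by the derivations of \<open>\<Delta> \<Rightarrow> e\<close>, can be enumerated.\<close>

section \<open>Recursive functions and semidecidable sets\<close>

text \<open>When a cut moves upward, its formula may lie inside an inserted sequence. Replacing it
  there produces a sequence that the input derivation need not have inserted, so V alone does not
  survive the reduction; this is why V is enlarged by derivability with cuts. Searching instead of
  transforming trees means that cut elimination is needed only as an existence statement about
  derivability, while the program needs only a semidecidable relation between input and output. Such
  relations are closed under conjunction, disjunction, existential and bounded universal
  quantification, and under recursion along decreasing codes, so no reduction on trees has to be
  programmed. The test made by the search is purely syntactic. Validity in lattice-ordered groups
  enters only in showing that the tree found is a derivation of the original calculus. Cancellation
  is needed there: a weakening step does not record the sequence it inserted and may admit several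
  readings.\<close>

definition total_recursive :: "nat \<Rightarrow> (nat list \<Rightarrow> nat) \<Rightarrow> bool" where
  "total_recursive k f \<longleftrightarrow> (\<exists>p. \<forall>xs. length xs = k \<longrightarrow> recf_eval p xs (f xs))"

named_theorems recursive_intros

text \<open>Only values at lists of length \<open>k\<close> matter, so a function produced by a
  scheme can be exchanged for a readable one after splitting the list into its entries.\<close>

lemma total_recursive_cong:
  assumes "total_recursive k f" and "\<And>xs. length xs = k \<Longrightarrow> f xs = g xs"
  shows "total_recursive k g"
  using assms by (simp add: total_recursive_def)

lemma total_recursive_nth [recursive_intros]: "i < k \<Longrightarrow> total_recursive k (\<lambda>xs. xs ! i)"
  unfolding total_recursive_def by (rule exI[of _ "Proj i"]) (auto intro: eval_Proj)

lemma total_recursive_comp: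
  assumes "total_recursive (length gs) f" and "\<And>g. g \<in> set gs \<Longrightarrow> total_recursive k g"
  shows "total_recursive k (\<lambda>xs. f (map (\<lambda>g. g xs) gs))"
proof -
  obtain p where p: "\<And>xs. length xs = length gs \<Longrightarrow> recf_eval p xs (f xs)"
    using assms(1) unfolding total_recursive_def by blast
  obtain q where q: "\<And>g xs. g \<in> set gs \<Longrightarrow> length xs = k \<Longrightarrow> recf_eval (q g) xs (g xs)"
    using assms(2) unfolding total_recursive_def by metis
  have "recf_eval (Comp p (map q gs)) xs (f (map (\<lambda>g. g xs) gs))" if "length xs = k" for xs
    using p q that by (intro eval_Comp[where ys = "map (\<lambda>g. g xs) gs"])
      (auto simp: list_all2_conv_all_nth)
  then show ?thesis
    unfolding total_recursive_def by blast
qed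

lemma total_recursive_comp1:
  assumes "total_recursive 1 h" and "total_recursive k f"
  shows "total_recursive k (\<lambda>xs. h [f xs])"
  using total_recursive_comp[of "[f]" h k] assms by auto

lemma total_recursive_comp2:
  assumes "total_recursive 2 h" and "total_recursive k f" and "total_recursive k g"
  shows "total_recursive k (\<lambda>xs. h [f xs, g xs])"
  using total_recursive_comp[of "[f, g]" h k] assms by (auto simp: numeral_2_eq_2)

lemma total_recursive_prec:
  assumes "total_recursive k f" and "total_recursive (Suc (Suc k)) g"
  shows "total_recursive (Suc k) (\<lambda>xs. rec_nat (f (tl xs)) (\<lambda>n y. g (n # y # tl xs)) (xs ! 0))"
proof -
  obtain p q where p: "\<And>xs. length xs = k \<Longrightarrow> recf_eval p xs (f xs)"
    and q: "\<And>xs. length xs = Suc (Suc k) \<Longrightarrow> recf_eval q xs (g xs)"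
    using assms unfolding total_recursive_def by blast
  have *: "recf_eval (Prec p q) (n # xs) (rec_nat (f xs) (\<lambda>n y. g (n # y # xs)) n)"
    if "length xs = k" for n xs
    using that by (induction n) (auto intro!: eval_Prec_0 eval_Prec_Suc p q)
  show ?thesis
    unfolding total_recursive_def
  proof (intro exI allI impI)
    fix xs :: "nat list" assume "length xs = Suc k"
    then obtain n ys where "xs = n # ys" "length ys = k"
      by (cases xs) auto
    then show "recf_eval (Prec p q) xs (rec_nat (f (tl xs)) (\<lambda>n y. g (n # y # tl xs)) (xs ! 0))"
      using * by simp
  qed
qed

lemma total_recursive_Suc [recursive_intros]:
  assumes "total_recursive k f"
  shows "total_recursive k (\<lambda>xs. Suc (f xs))"
proof -
  have "recf_eval Succ xs (Suc (xs ! 0))" if "length xs = 1" for xs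
    using that by (cases xs) (auto intro: eval_Succ)
  then have "total_recursive 1 (\<lambda>xs. Suc (xs ! 0))"
    unfolding total_recursive_def by blast
  from total_recursive_comp1[OF this assms] show ?thesis by simp
qed

lemma total_recursive_const [recursive_intros]: "total_recursive k (\<lambda>xs. c)"
proof (induction c)
  case 0
  show ?case
    unfolding total_recursive_def by (rule exI[of _ Zero]) (auto intro: eval_Zero)
qed (rule total_recursive_Suc)

lemma total_recursive_add [recursive_intros]:
  assumes "total_recursive k f" and "total_recursive k g"
  shows "total_recursive k (\<lambda>xs. f xs + g xs)"
proof -
  have eq: "rec_nat y (\<lambda>n. Suc) x = x + y" for x y
    by (induction x) auto
  have "total_recursive (Suc 1) (\<lambda>xs. rec_nat (tl xs ! 0) (\<lambda>n y. Suc ((n # y # tl xs) ! 1)) (xs ! 0))"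
    by (intro total_recursive_prec recursive_intros) auto
  then have "total_recursive 2 (\<lambda>xs. xs ! 0 + xs ! 1)"
    unfolding numeral_2_eq_2 One_nat_def by (rule total_recursive_cong) (auto simp: eq length_Suc_conv)
  from total_recursive_comp2[OF this assms] show ?thesis by simp
qed

lemma total_recursive_mult [recursive_intros]:
  assumes "total_recursive k f" and "total_recursive k g"
  shows "total_recursive k (\<lambda>xs. f xs * g xs)"
proof -
  have eq: "rec_nat 0 (\<lambda>n. (+) y) x = x * y" for x y :: nat
    by (induction x) auto
  have "total_recursive (Suc 1)
      (\<lambda>xs. rec_nat 0 (\<lambda>n y. (n # y # tl xs) ! 2 + (n # y # tl xs) ! 1) (xs ! 0))"
    by (intro total_recursive_prec recursive_intros) auto
  then have "total_recursive 2 (\<lambda>xs. xs ! 0 * xs ! 1)"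
    unfolding numeral_2_eq_2 One_nat_def by (rule total_recursive_cong) (auto simp: eq length_Suc_conv)
  from total_recursive_comp2[OF this assms] show ?thesis by simp
qed

lemma total_recursive_diff [recursive_intros]:
  assumes "total_recursive k f" and "total_recursive k g"
  shows "total_recursive k (\<lambda>xs. f xs - g xs)"
proof -
  \<comment> \<open>The predecessor is the recursion that returns its counter; subtraction then
    iterates it.\<close>
  have pred_eq: "rec_nat 0 (\<lambda>n y. n) x = x - Suc 0" for x
    by (cases x) auto
  have "total_recursive (Suc 0) (\<lambda>xs. rec_nat 0 (\<lambda>n y. (n # y # tl xs) ! 0) (xs ! 0))"
    by (intro total_recursive_prec recursive_intros) auto
  then have "total_recursive 1 (\<lambda>xs. xs ! 0 - 1)"
    unfolding One_nat_def
    by (rule total_recursive_cong) (auto simp: pred_eq length_Suc_conv)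
  from total_recursive_comp1[OF this]
  have pred: "total_recursive k f \<Longrightarrow> total_recursive k (\<lambda>xs. f xs - 1)" for k f
    by simp
  have eq: "rec_nat y (\<lambda>n y. y - Suc 0) x = y - x" for x y :: nat
    by (induction x) auto
  have "total_recursive (Suc 1)
      (\<lambda>xs. rec_nat (tl xs ! 0) (\<lambda>n y. (n # y # tl xs) ! 1 - 1) (xs ! 0))"
    by (intro total_recursive_prec recursive_intros pred) auto
  then have "total_recursive 2 (\<lambda>xs. xs ! 1 - xs ! 0)"
    unfolding numeral_2_eq_2 One_nat_def by (rule total_recursive_cong) (auto simp: eq length_Suc_conv)
  \<comment> \<open>The recursion runs over the subtrahend, which therefore stands first; hence the
    exchanged arguments.\<close>
  from total_recursive_comp2[OF this assms(2,1)] show ?thesis by simp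
qed

text \<open>Common source of bounded sums and products: \<open>h\<close> combines the accumulator
  with the next value of \<open>F\<close>.\<close>

lemma total_recursive_iterate:
  assumes F: "total_recursive (Suc k) F" and n: "total_recursive k n"
    and h: "total_recursive 2 h"
  shows "total_recursive k (\<lambda>xs. rec_nat c (\<lambda>i y. h [y, F (i # xs)]) (n xs))"
proof -
  \<comment> \<open>The step function of primitive recursion receives counter, accumulator and
    parameters, whereas \<open>F\<close> expects counter and parameters; \<open>?gs\<close> skips
    the accumulator at position 1.\<close>
  let ?gs = "(\<lambda>xs. xs ! 0) # map (\<lambda>i xs. xs ! (i + 2)) [0..<k]"
  have "total_recursive (Suc (Suc k)) (\<lambda>xs. F (map (\<lambda>g. g xs) ?gs))"
    using F by (intro total_recursive_comp) (auto intro!: total_recursive_nth)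
  then have "total_recursive (Suc (Suc k)) (\<lambda>xs. h [xs ! 1, F (map (\<lambda>g. g xs) ?gs)])"
    by (intro total_recursive_comp2 h recursive_intros) auto
  then have R: "total_recursive (Suc k) (\<lambda>xs. rec_nat c
      (\<lambda>i y. h [(i # y # tl xs) ! 1, F (map (\<lambda>g. g (i # y # tl xs)) ?gs)]) (xs ! 0))"
    by (intro total_recursive_prec recursive_intros)
  have "total_recursive k (\<lambda>xs. (\<lambda>xs. rec_nat c
      (\<lambda>i y. h [(i # y # tl xs) ! 1, F (map (\<lambda>g. g (i # y # tl xs)) ?gs)]) (xs ! 0))
        (map (\<lambda>g. g xs) (n # map (\<lambda>i xs. xs ! i) [0..<k])))"
    using R n by (intro total_recursive_comp) (auto intro!: total_recursive_nth)
  then show ?thesis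
  proof (rule total_recursive_cong)
    fix xs :: "nat list" assume "length xs = k"
    then have "map (\<lambda>i. xs ! i) [0..<k] = xs"
      using map_nth by blast
    then show "(\<lambda>xs. rec_nat c
      (\<lambda>i y. h [(i # y # tl xs) ! 1, F (map (\<lambda>g. g (i # y # tl xs)) ?gs)]) (xs ! 0))
        (map (\<lambda>g. g xs) (n # map (\<lambda>i xs. xs ! i) [0..<k]))
      = rec_nat c (\<lambda>i y. h [y, F (i # xs)]) (n xs)"
      by (simp add: comp_def)
  qed
qed

lemma total_recursive_sum:
  assumes "total_recursive (Suc k) F" and "total_recursive k n"
  shows "total_recursive k (\<lambda>xs. \<Sum>i<n xs. F (i # xs))"
proof -
  have "rec_nat 0 (\<lambda>i y. y + f i) m = (\<Sum>i<m. f i)" for m :: nat and f :: "nat \<Rightarrow> nat"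
    by (induction m) auto
  moreover have "total_recursive k (\<lambda>xs. rec_nat 0
      (\<lambda>i y. [y, F (i # xs)] ! 0 + [y, F (i # xs)] ! 1) (n xs))"
    by (intro total_recursive_iterate[where h = "\<lambda>xs. xs ! 0 + xs ! 1"] assms recursive_intros) auto
  ultimately show ?thesis by simp
qed

lemma total_recursive_prod:
  assumes "total_recursive (Suc k) F" and "total_recursive k n"
  shows "total_recursive k (\<lambda>xs. \<Prod>i<n xs. F (i # xs))"
proof -
  have "rec_nat 1 (\<lambda>i y. y * f i) m = (\<Prod>i<m. f i)" for m :: nat and f :: "nat \<Rightarrow> nat"
    by (induction m) auto
  moreover have "total_recursive k (\<lambda>xs. rec_nat 1
      (\<lambda>i y. [y, F (i # xs)] ! 0 * [y, F (i # xs)] ! 1) (n xs))"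
    by (intro total_recursive_iterate[where h = "\<lambda>xs. xs ! 0 * xs ! 1"] assms recursive_intros) auto
  ultimately show ?thesis by simp
qed

section \<open>Recursiveness of pairing, unpairing and binary digits\<close>

lemma total_recursive_prod_encode [recursive_intros]:
  assumes f: "total_recursive k f" and g: "total_recursive k g"
  shows "total_recursive k (\<lambda>xs. prod_encode (f xs, g xs))"
proof -
  have tri: "triangle n = (\<Sum>i<n. Suc i)" for n
    by (induction n) auto
  have "total_recursive (Suc k) (\<lambda>xs. Suc (xs ! 0))"
    by (intro recursive_intros) auto
  from total_recursive_sum[OF this total_recursive_add[OF f g]]
  have "total_recursive k (\<lambda>xs. triangle (f xs + g xs))"
    by (simp add: tri)
  then show ?thesis
    unfolding prod_encode_def prod.case by (intro recursive_intros f)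
qed

text \<open>Both components of a pair are bounded by its code, so a double bounded sum runs over all
  candidates and an indicator leaves only the right one. A general \<open>s\<close> serves both
  projections at once.\<close>

lemma total_recursive_prod_decode:
  assumes s: "total_recursive 2 s"
  shows "total_recursive 1 (\<lambda>xs. s [fst (prod_decode (xs ! 0)), snd (prod_decode (xs ! 0))])"
proof -
  \<comment> \<open>One minus the distance of two numbers, in truncated subtraction, is 1 exactly
    when they agree.\<close>
  define ind where "ind n a b = 1 - ((prod_encode (a, b) - n) + (n - prod_encode (a, b)))" for n a b
  have ind: "ind n a b = (if (a, b) = prod_decode n then 1 else 0)" for n a b
  proof -
    have "(a, b) = prod_decode n \<longleftrightarrow> prod_encode (a, b) = n"
      by (metis prod_decode_inverse prod_encode_inverse)
    then show ?thesis by (auto simp: ind_def)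
  qed
  let ?F = "\<lambda>xs. s [xs ! 1, xs ! 0] * ind (xs ! 2) (xs ! 1) (xs ! 0)"
  have "total_recursive 3 ?F"
    unfolding ind_def by (intro recursive_intros total_recursive_comp2[OF s]) auto
  then have "total_recursive (Suc (Suc 1)) ?F"
    by (simp add: numeral_3_eq_3)
  then have "total_recursive 1 (\<lambda>xs. \<Sum>a<Suc (xs ! 0). \<Sum>b<Suc ((a # xs) ! 1). ?F (b # a # xs))"
    by (intro total_recursive_sum total_recursive_Suc total_recursive_nth) auto
  then show ?thesis
  proof (rule total_recursive_cong)
    fix xs :: "nat list" assume "length xs = 1"
    then obtain n where xs: "xs = [n]" by (auto simp: length_Suc_conv)
    obtain a b where ab: "prod_decode n = (a, b)" by force
    then have n: "n = prod_encode (a, b)"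
      by (metis prod_decode_inverse)
    have "(\<Sum>i<Suc n. \<Sum>j<Suc n. s [i, j] * ind n i j)
      = (\<Sum>i<Suc n. \<Sum>j<Suc n. if j = b then (if i = a then s [a, b] else 0) else 0)"
      by (intro sum.cong) (auto simp: ind ab)
    also have "\<dots> = s [a, b]"
      using le_prod_encode_1[of a b] le_prod_encode_2[of b a] unfolding n[symmetric]
      by (simp del: sum.lessThan_Suc)
    finally show "(\<Sum>a<Suc (xs ! 0). \<Sum>b<Suc ((a # xs) ! 1). ?F (b # a # xs))
      = s [fst (prod_decode (xs ! 0)), snd (prod_decode (xs ! 0))]"
      by (simp add: xs ab del: sum.lessThan_Suc)
  qed
qed

lemma total_recursive_fst_prod_decode [recursive_intros]:
  assumes "total_recursive k f"
  shows "total_recursive k (\<lambda>xs. fst (prod_decode (f xs)))"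
  using total_recursive_comp1[OF total_recursive_prod_decode[of "\<lambda>xs. xs ! 0"] assms]
  by (simp add: total_recursive_nth)

lemma total_recursive_snd_prod_decode [recursive_intros]:
  assumes "total_recursive k f"
  shows "total_recursive k (\<lambda>xs. snd (prod_decode (f xs)))"
  using total_recursive_comp1[OF total_recursive_prod_decode[of "\<lambda>xs. xs ! 1"] assms]
  by (simp add: total_recursive_nth)

lemma total_recursive_power2 [recursive_intros]:
  assumes "total_recursive k f"
  shows "total_recursive k (\<lambda>xs. 2 ^ f xs)"
  using total_recursive_prod[OF total_recursive_const[of "Suc k" 2] assms] by simp

text \<open>The sum counts the positive multiples of \<open>b\<close> that do not exceed
  \<open>a\<close>. The range \<open>i < a\<close> is long enough because the quotient is at most
  \<open>a\<close>.\<close>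

lemma div_eq_sum:
  fixes a b :: nat
  assumes "b > 0"
  shows "a div b = (\<Sum>i<a. 1 - (Suc i * b - a))"
proof -
  have "(\<Sum>i<a. 1 - (Suc i * b - a)) = (\<Sum>i<a. if i < a div b then 1 else 0)"
  proof (rule sum.cong)
    fix i
    have "i < a div b \<longleftrightarrow> Suc i * b \<le> a"
      using assms less_eq_div_iff_mult_less_eq[of b "Suc i" a] by (simp add: Suc_le_eq)
    then show "1 - (Suc i * b - a) = (if i < a div b then 1 else 0)" by auto
  qed simp
  also have "\<dots> = card ({..<a} \<inter> {i. i < a div b})"
    by (simp add: sum.If_cases)
  also have "{..<a} \<inter> {i. i < a div b} = {..<a div b}"
    by (auto intro: order.strict_trans2)
  finally show ?thesis by simp
qed

lemma total_recursive_div: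
  assumes f: "total_recursive k f" and g: "total_recursive k g" and "\<And>xs. g xs > 0"
  shows "total_recursive k (\<lambda>xs. f xs div g xs)"
proof -
  let ?F = "\<lambda>xs. 1 - (Suc (xs ! 0) * (xs ! 2) - xs ! 1)"
  have "total_recursive (Suc 2) ?F"
    by (intro recursive_intros) auto
  from total_recursive_sum[OF this, of "\<lambda>xs. xs ! 0"]
  have "total_recursive 2 (\<lambda>xs. \<Sum>i<xs ! 0. ?F (i # xs))"
    by (simp add: total_recursive_nth)
  from total_recursive_comp2[OF this f g] show ?thesis
    using assms(3) by (simp add: div_eq_sum)
qed

text \<open>Membership in \<open>set_decode\<close> is a binary digit, the parity of a quotient by a
  power of 2.\<close>

lemma total_recursive_set_decode:
  "total_recursive 2 (\<lambda>xs. if xs ! 0 \<in> set_decode (xs ! 1) then 1 else 0)"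
proof -
  let ?D = "\<lambda>xs. xs ! 1 div 2 ^ (xs ! 0)"
  have "total_recursive 2 (\<lambda>xs. ?D xs - 2 * (?D xs div 2))"
    by (intro recursive_intros total_recursive_div) auto
  then show ?thesis
    by (rule total_recursive_cong)
      (auto simp: set_decode_def minus_mult_div_eq_mod odd_iff_mod_2_eq_one even_iff_mod_2_eq_zero)
qed

text \<open>\<open>f [w, n] = 0\<close> says that \<open>A n\<close> is confirmed by stage \<open>w\<close>; monotonicity in \<open>w\<close> allows
  finitely many confirmations to be combined at a common stage.\<close>

definition semi :: "(nat \<Rightarrow> bool) \<Rightarrow> bool" where
  "semi A \<longleftrightarrow> (\<exists>f. total_recursive 2 f \<and>
     (\<forall>n w w'. w \<le> w' \<longrightarrow> f [w, n] = 0 \<longrightarrow> f [w', n] = 0) \<and>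
     (\<forall>n. A n \<longleftrightarrow> (\<exists>w. f [w, n] = 0)))"

definition recursive_fun :: "(nat \<Rightarrow> nat) \<Rightarrow> bool" where
  "recursive_fun g \<longleftrightarrow> total_recursive 1 (\<lambda>xs. g (xs ! 0))"

lemma total_recursive_recursive_fun:
  assumes "recursive_fun g" and "total_recursive k f"
  shows "total_recursive k (\<lambda>xs. g (f xs))"
  using total_recursive_comp1[OF assms(1)[unfolded recursive_fun_def] assms(2)] by simp

lemma semiI:
  assumes "total_recursive 2 f"
    and "\<And>n w w'. w \<le> w' \<Longrightarrow> f [w, n] = 0 \<Longrightarrow> f [w', n] = 0"
    and "\<And>n. A n \<longleftrightarrow> (\<exists>w. f [w, n] = 0)"
  shows "semi A"
  using assms unfolding semi_def by blast

lemma semiE: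
  assumes "semi A"
  obtains f where "total_recursive 2 f"
    and "\<And>n w w'. w \<le> w' \<Longrightarrow> f [w, n] = 0 \<Longrightarrow> f [w', n] = 0"
    and "\<And>n. A n \<longleftrightarrow> (\<exists>w. f [w, n] = 0)"
proof -
  from assms obtain f where "total_recursive 2 f \<and>
     (\<forall>n w w'. w \<le> w' \<longrightarrow> f [w, n] = 0 \<longrightarrow> f [w', n] = 0) \<and>
     (\<forall>n. A n \<longleftrightarrow> (\<exists>w. f [w, n] = 0))"
    unfolding semi_def by (elim exE)
  then show thesis by (intro that[of f]) auto
qed

lemma semi_eq_0:
  assumes "recursive_fun g"
  shows "semi (\<lambda>n. g n = 0)"
  by (rule semiI[where f = "\<lambda>xs. g (xs ! 1)"])
    (use total_recursive_recursive_fun[OF assms total_recursive_nth[of 1 2]] in auto)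

lemma semi_vimage:
  assumes "semi A" and "recursive_fun g"
  shows "semi (\<lambda>n. A (g n))"
proof -
  from assms(1) obtain f where f: "total_recursive 2 f"
    "\<And>n w w'. w \<le> w' \<Longrightarrow> f [w, n] = 0 \<Longrightarrow> f [w', n] = 0"
    "\<And>n. A n \<longleftrightarrow> (\<exists>w. f [w, n] = 0)" by (rule semiE) blast
  show ?thesis
  proof (rule semiI[where f = "\<lambda>xs. f [xs ! 0, g (xs ! 1)]"])
    show "total_recursive 2 (\<lambda>xs. f [xs ! 0, g (xs ! 1)])"
      by (intro total_recursive_comp2 f total_recursive_nth
        total_recursive_recursive_fun[OF assms(2)]) simp_all
    show "f [[w', n] ! 0, g ([w', n] ! 1)] = 0"
      if "w \<le> w'" "f [[w, n] ! 0, g ([w, n] ! 1)] = 0" for n w w'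
      using that f(2)[of w w' "g n"] by simp
  qed (simp add: f(3))
qed

text \<open>A sum of naturals vanishes iff both terms do; the later of the two stages confirms both.
  Dually, \<open>semi_disj\<close> takes the product.\<close>

lemma semi_conj:
  assumes "semi A" and "semi B"
  shows "semi (\<lambda>n. A n \<and> B n)"
proof -
  from assms(1) obtain f where f: "total_recursive 2 f"
    "\<And>n w w'. w \<le> w' \<Longrightarrow> f [w, n] = 0 \<Longrightarrow> f [w', n] = 0"
    "\<And>n. A n \<longleftrightarrow> (\<exists>w. f [w, n] = 0)" by (rule semiE) blast
  from assms(2) obtain g where g: "total_recursive 2 g"
    "\<And>n w w'. w \<le> w' \<Longrightarrow> g [w, n] = 0 \<Longrightarrow> g [w', n] = 0"
    "\<And>n. B n \<longleftrightarrow> (\<exists>w. g [w, n] = 0)" by (rule semiE) blast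
  show ?thesis
  proof (rule semiI[where f = "\<lambda>xs. f xs + g xs"])
    show "(A n \<and> B n) = (\<exists>w. f [w, n] + g [w, n] = 0)" for n
    proof
      assume "A n \<and> B n"
      then obtain w w' where "f [w, n] = 0" "g [w', n] = 0"
        using f(3) g(3) by blast
      then have "f [max w w', n] + g [max w w', n] = 0"
        using f(2)[of w "max w w'" n] g(2)[of w' "max w w'" n] by simp
      then show "\<exists>w. f [w, n] + g [w, n] = 0" ..
    qed (auto simp: f(3) g(3))
    show "f [w', n] + g [w', n] = 0" if "w \<le> w'" "f [w, n] + g [w, n] = 0" for n w w'
      using that f(2)[of w w' n] g(2)[of w w' n] by simp
  qed (intro total_recursive_add f g)
qed

lemma semi_disj:
  assumes "semi A" and "semi B"
  shows "semi (\<lambda>n. A n \<or> B n)"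
proof -
  from assms(1) obtain f where f: "total_recursive 2 f"
    "\<And>n w w'. w \<le> w' \<Longrightarrow> f [w, n] = 0 \<Longrightarrow> f [w', n] = 0"
    "\<And>n. A n \<longleftrightarrow> (\<exists>w. f [w, n] = 0)" by (rule semiE) blast
  from assms(2) obtain g where g: "total_recursive 2 g"
    "\<And>n w w'. w \<le> w' \<Longrightarrow> g [w, n] = 0 \<Longrightarrow> g [w', n] = 0"
    "\<And>n. B n \<longleftrightarrow> (\<exists>w. g [w, n] = 0)" by (rule semiE) blast
  show ?thesis
  proof (rule semiI[where f = "\<lambda>xs. f xs * g xs"])
    show "f [w', n] * g [w', n] = 0" if "w \<le> w'" "f [w, n] * g [w, n] = 0" for n w w'
      using that f(2)[of w w' n] g(2)[of w w' n] by auto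
    show "(A n \<or> B n) = (\<exists>w. f [w, n] * g [w, n] = 0)" for n
      by (auto simp: f(3) g(3))
  qed (intro total_recursive_mult f g)
qed

text \<open>Dovetailing: stage \<open>w\<close> tries all witnesses below \<open>w\<close>, each up
  to stage \<open>w\<close>.\<close>

lemma semi_ex:
  assumes "semi A"
  shows "semi (\<lambda>n. \<exists>m. A (prod_encode (n, m)))"
proof -
  from assms(1) obtain f where f: "total_recursive 2 f"
    "\<And>n w w'. w \<le> w' \<Longrightarrow> f [w, n] = 0 \<Longrightarrow> f [w', n] = 0"
    "\<And>n. A n \<longleftrightarrow> (\<exists>w. f [w, n] = 0)" by (rule semiE) blast
  have f': "total_recursive 3 (\<lambda>xs. f [xs ! 1, prod_encode (xs ! 2, xs ! 0)])"
    by (intro total_recursive_comp2 f recursive_intros) auto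
  show ?thesis
  proof (rule semiI[where f = "\<lambda>xs. \<Prod>m<xs ! 0. f [xs ! 0, prod_encode (xs ! 1, m)]"])
    show "total_recursive 2 (\<lambda>xs. \<Prod>m<xs ! 0. f [xs ! 0, prod_encode (xs ! 1, m)])"
      using total_recursive_prod[where k = 2, OF _ total_recursive_nth[of 0 2]] f'
      by fastforce
    show "(\<exists>m. A (prod_encode (n, m)))
      \<longleftrightarrow> (\<exists>w. (\<Prod>m<[w, n] ! 0. f [[w, n] ! 0, prod_encode ([w, n] ! 1, m)]) = 0)" for n
    proof
      assume "\<exists>m. A (prod_encode (n, m))"
      then obtain m w where mw: "f [w, prod_encode (n, m)] = 0"
        using f(3) by blast
      then have "f [max w (Suc m), prod_encode (n, m)] = 0"
        \<comment> \<open>The stage must also exceed \<open>m\<close>, or the product would not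
          reach this witness.\<close>
        using f(2)[of w "max w (Suc m)"] by simp
      then show "\<exists>w. (\<Prod>m<[w, n] ! 0. f [[w, n] ! 0, prod_encode ([w, n] ! 1, m)]) = 0"
        by (intro exI[of _ "max w (Suc m)"]) auto
    qed (auto simp: f(3))
    show "(\<Prod>m<[w', n] ! 0. f [[w', n] ! 0, prod_encode ([w', n] ! 1, m)]) = 0"
      if "w \<le> w'" "(\<Prod>m<[w, n] ! 0. f [[w, n] ! 0, prod_encode ([w, n] ! 1, m)]) = 0" for n w w'
    proof -
      from that(2) obtain m where "m < w" "f [w, prod_encode (n, m)] = 0"
        by auto
      then show ?thesis
        using that(1) f(2)[of w w' "prod_encode (n, m)"] by (auto intro!: bexI[of _ m])
    qed
  qed
qed

lemma semi_ball:
  assumes "semi A" and "recursive_fun h"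
  shows "semi (\<lambda>n. \<forall>m<h n. A (prod_encode (n, m)))"
proof -
  from assms(1) obtain f where f: "total_recursive 2 f"
    "\<And>n w w'. w \<le> w' \<Longrightarrow> f [w, n] = 0 \<Longrightarrow> f [w', n] = 0"
    "\<And>n. A n \<longleftrightarrow> (\<exists>w. f [w, n] = 0)" by (rule semiE) blast
  have f': "total_recursive 3 (\<lambda>xs. f [xs ! 1, prod_encode (xs ! 2, xs ! 0)])"
    by (intro total_recursive_comp2 f recursive_intros) auto
  show ?thesis
  proof (rule semiI[where f = "\<lambda>xs. \<Sum>m<h (xs ! 1). f [xs ! 0, prod_encode (xs ! 1, m)]"])
    have "total_recursive 2 (\<lambda>xs. h (xs ! 1))"
      by (rule total_recursive_recursive_fun[OF assms(2) total_recursive_nth]) simp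
    from total_recursive_sum[where k = 2, OF _ this]
    show "total_recursive 2 (\<lambda>xs. \<Sum>m<h (xs ! 1). f [xs ! 0, prod_encode (xs ! 1, m)])"
      using f' by fastforce
    show "(\<forall>m<h n. A (prod_encode (n, m)))
      \<longleftrightarrow> (\<exists>w. (\<Sum>m<h ([w, n] ! 1). f [[w, n] ! 0, prod_encode ([w, n] ! 1, m)]) = 0)" for n
    proof
      assume "\<forall>m<h n. A (prod_encode (n, m))"
      then have "\<forall>m. \<exists>w. m < h n \<longrightarrow> f [w, prod_encode (n, m)] = 0"
        by (simp add: f(3))
      then obtain w where w: "\<And>m. m < h n \<Longrightarrow> f [w m, prod_encode (n, m)] = 0"
        using choice[of "\<lambda>m w. m < h n \<longrightarrow> f [w, prod_encode (n, m)] = 0"] by blast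
      \<comment> \<open>The sum of the individual stages is a convenient upper bound for all of
        them.\<close>
      define W where "W = (\<Sum>m<h n. w m)"
      have "f [W, prod_encode (n, m)] = 0" if "m < h n" for m
      proof (rule f(2)[OF _ w])
        show "w m \<le> W"
          unfolding W_def using that by (intro member_le_sum) auto
      qed (rule that)
      then show "\<exists>w. (\<Sum>m<h ([w, n] ! 1). f [[w, n] ! 0, prod_encode ([w, n] ! 1, m)]) = 0"
        by (intro exI[of _ W]) auto
    qed (auto simp: f(3))
    show "(\<Sum>m<h ([w', n] ! 1). f [[w', n] ! 0, prod_encode ([w', n] ! 1, m)]) = 0"
      if "w \<le> w'" "(\<Sum>m<h ([w, n] ! 1). f [[w, n] ! 0, prod_encode ([w, n] ! 1, m)]) = 0" for n w w'
      using that f(2)[OF that(1)] by simp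
  qed
qed

text \<open>A search over \<open>m\<close> alone could wait forever on a candidate that is never
  confirmed. The search therefore runs over codes of pairs of a stage and a candidate, for which the
  test is total, and then projects to the candidate.\<close>

lemma semi_uniformize:
  assumes "semi A"
  shows "\<exists>p. \<forall>n. (\<exists>m. A (prod_encode (n, m))) \<longrightarrow>
    (\<exists>m. A (prod_encode (n, m)) \<and> recf_eval p [n] m)"
proof -
  from assms(1) obtain f where f: "total_recursive 2 f"
    "\<And>n. A n \<longleftrightarrow> (\<exists>w. f [w, n] = 0)" by (rule semiE) blast
  define g where "g xs = f [fst (prod_decode (xs ! 0)), prod_encode (xs ! 1, snd (prod_decode (xs ! 0)))]"
    for xs
  have "total_recursive 2 g"
    unfolding g_def by (intro total_recursive_comp2 f recursive_intros) auto
  then obtain q where "\<And>xs. length xs = 2 \<Longrightarrow> recf_eval q xs (g xs)"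
    unfolding total_recursive_def by blast
  then have q: "recf_eval q [v, n] (g [v, n])" for v n
    by simp
  have "total_recursive 1 (\<lambda>xs. snd (prod_decode (xs ! 0)))"
    by (intro recursive_intros) auto
  then obtain r where "\<And>xs. length xs = 1 \<Longrightarrow> recf_eval r xs (snd (prod_decode (xs ! 0)))"
    unfolding total_recursive_def by blast
  then have r: "recf_eval r [v] (snd (prod_decode v))" for v
    by (metis One_nat_def length_Cons list.size(3) nth_Cons_0)
  show ?thesis
  proof (intro exI[of _ "Comp r [Mu q]"] allI impI)
    fix n assume "\<exists>m. A (prod_encode (n, m))"
    then obtain m w where "f [w, prod_encode (n, m)] = 0"
      using f(2) by blast
    then have "g [prod_encode (w, m), n] = 0"
      by (simp add: g_def)
    then have *: "\<exists>v. g [v, n] = 0" ..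
    define v where "v = (LEAST v. g [v, n] = 0)"
    have v: "g [v, n] = 0"
      using * unfolding v_def by (rule LeastI_ex)
    have least: "\<exists>k. g [u, n] = Suc k" if "u < v" for u
      using not_less_Least[OF that[unfolded v_def]] not0_implies_Suc by auto
    have "recf_eval (Mu q) [n] v"
      using q[of v n] v q[of _ n] by (intro eval_Mu) (simp, metis least)
    then have "recf_eval (Comp r [Mu q]) [n] (snd (prod_decode v))"
      by (intro eval_Comp[where ys = "[v]"] r) simp
    moreover have "A (prod_encode (n, snd (prod_decode v)))"
      using v f(2) by (auto simp: g_def)
    ultimately show "\<exists>m. A (prod_encode (n, m)) \<and> recf_eval (Comp r [Mu q]) [n] m"
      by blast
  qed
qed

subsection \<open>Semidecidable predicates on coded types\<close>

text \<open>On the types of the calculus \<open>enc\<close> is the given Goedel numbering, e.g. \<open>tm_code\<close> for terms;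
  \<open>semidec\<close> and \<open>computable\<close> refer to these codings.\<close>

class coded =
  fixes enc :: "'a \<Rightarrow> nat"
  assumes enc_eq_iff [simp]: "enc x = enc y \<longleftrightarrow> x = y"
    and semi_range_enc: "semi (\<lambda>n. n \<in> range enc)"

definition semidec :: "('a::coded \<Rightarrow> bool) \<Rightarrow> bool" where
  "semidec P \<longleftrightarrow> semi (\<lambda>n. \<exists>x. n = enc x \<and> P x)"

lemma semi_cong:
  assumes "semi A" and "\<And>n. A n \<longleftrightarrow> B n"
  shows "semi B"
proof -
  have "A = B"
    using assms(2) by (rule ext)
  with assms(1) show ?thesis by simp
qed

instantiation nat :: coded
begin
definition enc_nat :: "nat \<Rightarrow> nat" where [simp]: "enc_nat n = n"
instance
proof
  have "recursive_fun (\<lambda>n. 0)"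
    by (simp add: recursive_fun_def total_recursive_const)
  from semi_eq_0[OF this] show "semi (\<lambda>n. n \<in> range (enc :: nat \<Rightarrow> nat))"
    by simp
qed simp
end

lemma recursive_fst: "recursive_fun (\<lambda>n. fst (prod_decode n))"
  and recursive_snd: "recursive_fun (\<lambda>n. snd (prod_decode n))"
  unfolding recursive_fun_def by (intro recursive_intros; simp)+

instantiation prod :: (coded, coded) coded
begin
definition enc_prod :: "'a \<times> 'b \<Rightarrow> nat" where
  enc_prod [simp]: "enc_prod z = prod_encode (enc (fst z), enc (snd z))"
instance
proof
  have "n \<in> range (enc :: 'a \<times> 'b \<Rightarrow> nat) \<longleftrightarrow>
    fst (prod_decode n) \<in> range (enc :: 'a \<Rightarrow> nat) \<and> snd (prod_decode n) \<in> range (enc :: 'b \<Rightarrow> nat)" for n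
  proof
    assume "fst (prod_decode n) \<in> range (enc :: 'a \<Rightarrow> nat) \<and> snd (prod_decode n) \<in> range (enc :: 'b \<Rightarrow> nat)"
    then obtain x :: 'a and y :: 'b where "prod_decode n = (enc x, enc y)"
      by (metis imageE prod.collapse)
    then have "n = enc (x, y)"
      by simp (metis prod_decode_inverse)
    then show "n \<in> range (enc :: 'a \<times> 'b \<Rightarrow> nat)" by blast
  qed auto
  moreover have "semi (\<lambda>n. fst (prod_decode n) \<in> range (enc :: 'a \<Rightarrow> nat)
      \<and> snd (prod_decode n) \<in> range (enc :: 'b \<Rightarrow> nat))"
    by (rule semi_conj[OF semi_vimage[OF semi_range_enc recursive_fst]
      semi_vimage[OF semi_range_enc recursive_snd]])
  ultimately show "semi (\<lambda>n. n \<in> range (enc :: 'a \<times> 'b \<Rightarrow> nat))"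
    by simp
qed (auto simp: prod_eq_iff)
end

text \<open>For a total function a semidecidable graph amounts to recursiveness. In this form
  composition needs only an existential quantifier, and structural recursion only an inductive
  description of the graph.\<close>

definition computable :: "('a::coded \<Rightarrow> 'b::coded) \<Rightarrow> bool" where
  "computable f \<longleftrightarrow> semidec (\<lambda>z. snd z = f (fst z))"

named_theorems computable_intros

lemma semidec_iff_semi: "semidec A \<longleftrightarrow> semi A"
  by (simp add: semidec_def)

lemma semidec_range_enc: "semidec (\<lambda>n. n \<in> range (enc :: 'a::coded \<Rightarrow> nat))"
  using semi_range_enc by (simp add: semidec_iff_semi)

text \<open>Bootstrapping version of \<open>semidec_vimage\<close>: \<open>g\<close> computes
  \<open>h\<close> on codes, so tuples can be rearranged before closure of \<open>computable\<close>
  under pairing and projections is available. The range test is added because \<open>g\<close> may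
  send a number that is no code to a code.\<close>

lemma semidec_vimage_tracked:
  fixes h :: "'a::coded \<Rightarrow> 'b::coded"
  assumes "semidec P" and "recursive_fun g" and "\<And>x. enc (h x) = g (enc x)"
  shows "semidec (\<lambda>x. P (h x))"
proof -
  have "semi (\<lambda>n. n \<in> range (enc :: 'a \<Rightarrow> nat) \<and> (\<exists>x. g n = enc x \<and> P x))"
    using semi_vimage[OF assms(1)[unfolded semidec_def] assms(2)]
    by (rule semi_conj[OF semi_range_enc])
  then show ?thesis
    unfolding semidec_def by (rule semi_cong) (auto simp flip: assms(3))
qed

lemma recursive_fun_id: "recursive_fun (\<lambda>n. n)"
  unfolding recursive_fun_def by (intro recursive_intros) simp

lemma recursive_fun_pair:
  "recursive_fun f \<Longrightarrow> recursive_fun g \<Longrightarrow> recursive_fun (\<lambda>n. prod_encode (f n, g n))"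
  unfolding recursive_fun_def by (intro recursive_intros)

lemma recursive_fun_comp: "recursive_fun f \<Longrightarrow> recursive_fun g \<Longrightarrow> recursive_fun (\<lambda>n. f (g n))"
  using total_recursive_recursive_fun unfolding recursive_fun_def[of g] recursive_fun_def[of "\<lambda>n. f (g n)"] .

lemmas recursive_fun_fst = recursive_fun_comp[OF recursive_fst]
lemmas recursive_fun_snd = recursive_fun_comp[OF recursive_snd]

lemmas recursive_fun_intros = recursive_fun_pair recursive_fun_fst recursive_fun_snd recursive_fun_id

section \<open>Closure properties of semidecidable predicates and computable functions\<close>

lemma semidec_conj [computable_intros]:
  assumes "semidec P" and "semidec Q"
  shows "semidec (\<lambda>x. P x \<and> Q x)"
  using semi_conj[OF assms[unfolded semidec_def]] unfolding semidec_def
  by (rule semi_cong) auto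

lemma semidec_disj [computable_intros]:
  assumes "semidec P" and "semidec Q"
  shows "semidec (\<lambda>x. P x \<or> Q x)"
  using semi_disj[OF assms[unfolded semidec_def]] unfolding semidec_def
  by (rule semi_cong) auto

lemma semidec_ex [computable_intros]:
  assumes "semidec (\<lambda>z. P (fst z) (snd z))"
  shows "semidec (\<lambda>x. \<exists>y. P x y)"
  using semi_ex[OF assms[unfolded semidec_def]] unfolding semidec_def
  by (rule semi_cong) auto

lemma semidec_vimage:
  fixes f :: "'a::coded \<Rightarrow> 'b::coded"
  assumes "semidec P" and "computable f"
  shows "semidec (\<lambda>x. P (f x))"
proof -
  have "semidec (\<lambda>z :: 'a \<times> 'b. P (snd z))"
    using assms(1) recursive_snd by (rule semidec_vimage_tracked) simp
  then have "semidec (\<lambda>x. \<exists>y. y = f x \<and> P y)"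
    by (intro semidec_ex semidec_conj assms(2)[unfolded computable_def])
  then show ?thesis by simp
qed

lemma computable_tracked:
  fixes h :: "'a::coded \<Rightarrow> 'b::coded"
  assumes "recursive_fun g" and "\<And>x. enc (h x) = g (enc x)"
  shows "computable h"
proof -
  \<comment> \<open>The symmetric truncated difference vanishes exactly on the graph of
    \<open>g\<close>.\<close>
  let ?d = "\<lambda>n. (snd (prod_decode n) - g (fst (prod_decode n)))
    + (g (fst (prod_decode n)) - snd (prod_decode n))"
  have "recursive_fun ?d"
    using recursive_fun_comp[OF assms(1) recursive_fst] recursive_snd
    unfolding recursive_fun_def by (intro total_recursive_add total_recursive_diff)
  from semi_conj[OF semi_range_enc semi_eq_0[OF this]]
  have "semi (\<lambda>n. n \<in> range (enc :: 'a \<times> 'b \<Rightarrow> nat) \<and> ?d n = 0)" .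
  moreover have "(n \<in> range (enc :: 'a \<times> 'b \<Rightarrow> nat) \<and> ?d n = 0)
      \<longleftrightarrow> (\<exists>z. n = enc z \<and> snd z = h (fst z))" for n
  proof -
    have *: "?d (enc z) = 0 \<longleftrightarrow> snd z = h (fst z)" for z :: "'a \<times> 'b"
    proof -
      have "?d (enc z) = 0 \<longleftrightarrow> enc (snd z) = enc (h (fst z))"
        by (simp only: enc_prod assms(2) prod_encode_inverse fst_conv snd_conv) auto
      then show ?thesis by simp
    qed
    have "n \<in> range (enc :: 'a \<times> 'b \<Rightarrow> nat) \<and> Q n
        \<longleftrightarrow> (\<exists>z :: 'a \<times> 'b. n = enc z \<and> Q (enc z))" for Q
      by blast
    from this[of "\<lambda>n. ?d n = 0"] show ?thesis
      unfolding * .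
  qed
  ultimately show ?thesis
    unfolding computable_def semidec_def by (rule semi_cong)
qed

lemma computable_ident [computable_intros]: "computable (\<lambda>x. x)"
  using recursive_fun_id by (rule computable_tracked) simp

lemma computable_const [computable_intros]: "computable (\<lambda>x. c)"
  by (rule computable_tracked[of "\<lambda>n. enc c"])
    (simp_all add: recursive_fun_def total_recursive_const)

lemma computable_pair [computable_intros]:
  fixes f :: "'a::coded \<Rightarrow> 'b::coded" and g :: "'a \<Rightarrow> 'c::coded"
  assumes "computable f" and "computable g"
  shows "computable (\<lambda>x. (f x, g x))"
proof -
  have "semidec (\<lambda>z :: 'a \<times> 'b \<times> 'c. (\<lambda>z. snd z = f (fst z)) (fst z, fst (snd z)))"
    by (rule semidec_vimage_tracked[OF assms(1)[unfolded computable_def],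
      where h = "\<lambda>z. (fst z, fst (snd z))" and g = "\<lambda>n. prod_encode (fst (prod_decode n),
      fst (prod_decode (snd (prod_decode n))))"]) (intro recursive_fun_intros, simp)
  moreover have "semidec (\<lambda>z :: 'a \<times> 'b \<times> 'c. (\<lambda>z. snd z = g (fst z)) (fst z, snd (snd z)))"
    by (rule semidec_vimage_tracked[OF assms(2)[unfolded computable_def],
      where h = "\<lambda>z. (fst z, snd (snd z))" and g = "\<lambda>n. prod_encode (fst (prod_decode n),
      snd (prod_decode (snd (prod_decode n))))"]) (intro recursive_fun_intros, simp)
  ultimately have "semidec (\<lambda>z :: 'a \<times> 'b \<times> 'c. fst (snd z) = f (fst z) \<and> snd (snd z) = g (fst z))"
    by (simp add: semidec_conj)
  then show ?thesis
    by (simp add: computable_def prod_eq_iff)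
qed

lemma computable_comp:
  fixes f :: "'b::coded \<Rightarrow> 'c::coded" and g :: "'a::coded \<Rightarrow> 'b"
  assumes "computable f" and "computable g"
  shows "computable (\<lambda>x. f (g x))"
proof -
  have "semidec (\<lambda>z :: ('a \<times> 'c) \<times> 'b. (\<lambda>z. snd z = g (fst z)) (fst (fst z), snd z))"
    by (rule semidec_vimage_tracked[OF assms(2)[unfolded computable_def],
      where h = "\<lambda>z. (fst (fst z), snd z)" and g = "\<lambda>n. prod_encode (fst (prod_decode (fst (prod_decode n))),
      snd (prod_decode n))"]) (intro recursive_fun_intros, simp)
  moreover have "semidec (\<lambda>z :: ('a \<times> 'c) \<times> 'b. (\<lambda>z. snd z = f (fst z)) (snd z, snd (fst z)))"
    by (rule semidec_vimage_tracked[OF assms(1)[unfolded computable_def],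
      where h = "\<lambda>z. (snd z, snd (fst z))" and g = "\<lambda>n. prod_encode (snd (prod_decode n),
      snd (prod_decode (fst (prod_decode n))))"]) (intro recursive_fun_intros, simp)
  ultimately have "semidec (\<lambda>z :: 'a \<times> 'c. \<exists>y. y = g (fst z) \<and> snd z = f y)"
    by (intro semidec_ex) (simp add: semidec_conj)
  then show ?thesis
    by (simp add: computable_def)
qed

lemma computable_fst [computable_intros]: "computable f \<Longrightarrow> computable (\<lambda>x. fst (f x))"
  by (rule computable_comp[where f = fst]) (rule computable_tracked[OF recursive_fst], simp)

lemma computable_snd [computable_intros]: "computable f \<Longrightarrow> computable (\<lambda>x. snd (f x))"
  by (rule computable_comp[where f = snd]) (rule computable_tracked[OF recursive_snd], simp)

lemma computable_enc [computable_intros]: "computable f \<Longrightarrow> computable (\<lambda>x. enc (f x))"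
  by (rule computable_comp[where f = enc]) (rule computable_tracked[OF recursive_fun_id], simp)

lemma computable_prod_encode [computable_intros]:
  "computable f \<Longrightarrow> computable g \<Longrightarrow> computable (\<lambda>x. prod_encode (f x, g x))"
  by (rule computable_comp[where f = prod_encode and g = "\<lambda>x. (f x, g x)"])
    (rule computable_tracked[OF recursive_fun_id], simp, rule computable_pair)

lemma computable_Suc [computable_intros]: "computable f \<Longrightarrow> computable (\<lambda>x. Suc (f x))"
proof (rule computable_comp[where f = Suc])
  have "recursive_fun Suc"
    unfolding recursive_fun_def by (intro recursive_intros) simp
  then show "computable Suc" by (rule computable_tracked) simp
qed

text \<open>The graph of \<open>f\<close> is a preimage of the graph of its coded version, by
  injectivity of \<open>enc\<close>. Computability of constructors thereby reduces to arithmetic on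
  codes.\<close>

lemma computable_from_enc:
  fixes f :: "'a::coded \<Rightarrow> 'b::coded"
  assumes "computable (\<lambda>x. enc (f x))"
  shows "computable f"
proof -
  have "semidec (\<lambda>z :: 'a \<times> 'b. (\<lambda>z. snd z = enc (f (fst z))) (fst z, enc (snd z)))"
    by (rule semidec_vimage_tracked[OF assms[unfolded computable_def] recursive_fun_id,
      where h = "\<lambda>z. (fst z, enc (snd z))"]) simp
  then show ?thesis
    by (simp add: computable_def)
qed

lemma semidec_eq [computable_intros]:
  assumes "computable f" and "computable g"
  shows "semidec (\<lambda>x. f x = g x)"
  using semidec_vimage[OF assms(2)[unfolded computable_def], of "\<lambda>x. (x, f x)"] assms(1)
  by (simp add: computable_intros)

lemma semidec_vimage2:
  assumes "semidec (\<lambda>z. Q (fst z) (snd z))" and "computable f" and "computable g"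
  shows "semidec (\<lambda>x. Q (f x) (g x))"
  using semidec_vimage[OF assms(1) computable_pair[OF assms(2,3)]] by simp

text \<open>Semidecidable predicates are not closed under negation, so non-membership needs its own
  proof; it is available because the binary digit is recursive.\<close>

lemma semidec_set_decode:
  "semi (\<lambda>z. fst (prod_decode z) \<in> set_decode (snd (prod_decode z)))"
  "semi (\<lambda>z. fst (prod_decode z) \<notin> set_decode (snd (prod_decode z)))"
proof -
  let ?b = "\<lambda>z. if fst (prod_decode z) \<in> set_decode (snd (prod_decode z)) then 1 else 0 :: nat"
  have "recursive_fun ?b"
    unfolding recursive_fun_def
    using total_recursive_comp2[OF total_recursive_set_decode,
        of 1 "\<lambda>xs. fst (prod_decode (xs ! 0))" "\<lambda>xs. snd (prod_decode (xs ! 0))"]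
    by (simp add: recursive_intros)
  moreover from this have "recursive_fun (\<lambda>z. 1 - ?b z)"
    unfolding recursive_fun_def by (intro recursive_intros)
  ultimately have *: "semi (\<lambda>z. ?b z = 0)" "semi (\<lambda>z. 1 - ?b z = 0)"
    by (simp_all only: semi_eq_0)
  from *(2) show "semi (\<lambda>z. fst (prod_decode z) \<in> set_decode (snd (prod_decode z)))"
    by (rule semi_cong) simp
  from *(1) show "semi (\<lambda>z. fst (prod_decode z) \<notin> set_decode (snd (prod_decode z)))"
    by (rule semi_cong) simp
qed

lemma semidec_mem_set_decode [computable_intros]:
  assumes "computable f" and "computable g"
  shows "semidec (\<lambda>x. f x \<in> set_decode (g x))" and "semidec (\<lambda>x. f x \<notin> set_decode (g x))"
  using semidec_set_decode[folded semidec_iff_semi, THEN semidec_vimage, OF computable_prod_encode[OF assms]]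
  by simp_all

lemma semidec_ball_less:
  assumes "semidec (\<lambda>z. P (fst z) (snd z))"
  shows "semidec (\<lambda>n::nat. \<forall>m<n. P n m)"
  using semi_ball[OF assms[unfolded semidec_def] recursive_fun_id] unfolding semidec_iff_semi
  by (rule semi_cong) auto

text \<open>A witness for \<open>A n\<close> is the bit mask \<open>F\<close> of a finite set that contains \<open>n\<close> and in which every
  element is justified by smaller elements.\<close>

lemma semidec_rules:
  fixes A B :: "nat \<Rightarrow> bool"
  assumes A: "\<And>n. A n \<longleftrightarrow> B n \<or> (\<exists>a b. T n a b \<and> A a \<and> A b)"
    and T: "\<And>n a b. T n a b \<Longrightarrow> a < n \<and> b < n"
    and B: "semidec B" and ST: "semidec (\<lambda>z. T (fst z) (fst (snd z)) (snd (snd z)))"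
  shows "semidec A"
proof -
  define just where "just F m \<longleftrightarrow> B m \<or> (\<exists>a b. T m a b \<and> a \<in> set_decode F \<and> b \<in> set_decode F)" for F m
  have eq: "A n \<longleftrightarrow> (\<exists>F. n \<in> set_decode F \<and> (\<forall>m<F. m \<notin> set_decode F \<or> just F m))" for n
  proof
    assume "A n"
    \<comment> \<open>The mask collects everything true up to \<open>n\<close>. Since premises are
      smaller than their conclusion, this set contains a justification for each of its
      elements.\<close>
    define F where "F = set_encode {m. m \<le> n \<and> A m}"
    have F: "set_decode F = {m. m \<le> n \<and> A m}"
      unfolding F_def by (rule set_encode_inverse) simp
    have "just F m" if "m \<in> set_decode F" for m
      using A[of m] that T[of m] unfolding just_def F by fastforce
    with \<open>A n\<close> show "\<exists>F. n \<in> set_decode F \<and> (\<forall>m<F. m \<notin> set_decode F \<or> just F m)"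
      by (intro exI[of _ F]) (auto simp: F)
  next
    assume "\<exists>F. n \<in> set_decode F \<and> (\<forall>m<F. m \<notin> set_decode F \<or> just F m)"
    then obtain F where n: "n \<in> set_decode F" and F: "\<And>m. m < F \<Longrightarrow> m \<in> set_decode F \<Longrightarrow> just F m"
      by blast
    \<comment> \<open>Bit \<open>m\<close> alone contributes \<open>2 ^ m > m\<close>, so the bound
      \<open>m < F\<close> in the quantifier misses no element of the mask.\<close>
    have less: "m < F" if "m \<in> set_decode F" for m
    proof -
      from that have "2 ^ m \<le> F"
        by (auto simp: set_decode_def intro: ccontr)
      then show ?thesis
        using less_exp[of m] by (rule order.strict_trans2[rotated])
    qed
    show "A n"
      using n
    proof (induction n rule: less_induct)
      case (less n)
      then have "just F n"
        using F \<open>\<And>m. m \<in> set_decode F \<Longrightarrow> m < F\<close> by blast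
      then show ?case
        using A[of n] T less.IH unfolding just_def by blast
    qed
  qed
  have "semidec (\<lambda>n. \<exists>F. n \<in> set_decode F \<and> (\<forall>m<F. m \<notin> set_decode F \<or> just F m))"
  proof -
    have TJ: "semidec (\<lambda>x. T (f x) (g x) (h x))"
      if "computable f" "computable g" "computable h" for f g h :: "'x::coded \<Rightarrow> nat"
      using semidec_vimage[OF ST, of "\<lambda>x. (f x, g x, h x)"] that
      by (simp add: computable_intros)
    have "semidec (\<lambda>z. snd z \<notin> set_decode (fst z) \<or> just (fst z) (snd z))"
      unfolding just_def by (intro computable_intros semidec_vimage[OF B] TJ)
    then have "semidec (\<lambda>F. \<forall>m<F. m \<notin> set_decode F \<or> just F m)"
      by (rule semidec_ball_less)
    note bounded = semidec_vimage[OF this]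
    show ?thesis
      by (intro computable_intros bounded)
  qed
  then show ?thesis
    unfolding semidec_iff_semi by (rule semi_cong) (rule eq[symmetric])
qed

text \<open>Transfer of \<open>semidec_rules\<close> from numbers to coded types. Rules have exactly
  two premises; a rule with one premise is expressed by repeating it.\<close>

lemma semidec_inductive:
  fixes P B :: "'a::coded \<Rightarrow> bool"
  assumes P: "\<And>x. P x \<longleftrightarrow> B x \<or> (\<exists>y z. T x y z \<and> P y \<and> P z)"
    and T: "\<And>x y z. T x y z \<Longrightarrow> enc y < enc x \<and> enc z < enc x"
    and B: "semidec B" and ST: "semidec (\<lambda>z. T (fst z) (fst (snd z)) (snd (snd z)))"
  shows "semidec P"
proof -
  define A where "A n \<longleftrightarrow> (\<exists>x. n = enc x \<and> P x)" for n
  define T' where "T' n a b \<longleftrightarrow> (\<exists>x y z. n = enc x \<and> a = enc y \<and> b = enc z \<and> T x y z)" for n a b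
  have TJ: "semidec (\<lambda>x. T (f x) (g x) (h x))"
    if "computable f" "computable g" "computable h" for f g h :: "'x::coded \<Rightarrow> 'a"
    using semidec_vimage[OF ST, of "\<lambda>x. (f x, g x, h x)"] that
    by (simp add: computable_intros)
  have "semidec A"
  proof (rule semidec_rules)
    show "A n \<longleftrightarrow> (\<exists>x. n = enc x \<and> B x) \<or> (\<exists>a b. T' n a b \<and> A a \<and> A b)" for n
    proof
      assume "A n"
      then obtain x where x: "n = enc x" "P x"
        by (auto simp: A_def)
      from x(2) P[of x] consider "B x" | y z where "T x y z" "P y" "P z"
        by blast
      then show "(\<exists>x. n = enc x \<and> B x) \<or> (\<exists>a b. T' n a b \<and> A a \<and> A b)"
      proof cases
        case 1
        with x(1) show ?thesis by blast
      next
        case 2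
        then have "T' n (enc y) (enc z)" "A (enc y)" "A (enc z)"
          using x(1) by (auto simp: T'_def A_def)
        then show ?thesis by blast
      qed
    next
      assume "(\<exists>x. n = enc x \<and> B x) \<or> (\<exists>a b. T' n a b \<and> A a \<and> A b)"
      then show "A n"
      proof (elim disjE exE conjE)
        fix a b assume "T' n a b" "A a" "A b"
        then obtain x y z where x: "n = enc x" and "T x y z" "P y" "P z"
          by (auto simp: T'_def A_def)
        with P[of x] have "P x" by blast
        with x show "A n" by (auto simp: A_def)
      next
        fix x assume "n = enc x" "B x"
        with P[of x] show "A n" by (auto simp: A_def)
      qed
    qed
    show "a < n \<and> b < n" if "T' n a b" for n a b
      using that T by (auto simp: T'_def)
    show "semidec (\<lambda>n. \<exists>x. n = enc x \<and> B x)"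
      by (intro computable_intros semidec_vimage[OF B])
    show "semidec (\<lambda>z. T' (fst z) (fst (snd z)) (snd (snd z)))"
      unfolding T'_def by (intro computable_intros TJ)
  qed
  then show ?thesis
    unfolding semidec_iff_semi semidec_def[of P] by (rule semi_cong) (rule A_def)
qed

lemma semidec_False [computable_intros]: "semidec (\<lambda>x. False)"
  using semidec_eq[OF computable_const[of 0] computable_const[of "1::nat"]] by simp

text \<open>The pairing function is \<open>triangle (a + b) + a\<close>: increasing \<open>a\<close>
  raises the second summand, and increasing \<open>b\<close> alone moves to a later diagonal. This
  provides the decrease of codes required by \<open>semidec_inductive\<close>.\<close>

lemma prod_encode_strict_mono:
  assumes "a \<le> a'" and "b \<le> b'" and "a < a' \<or> b < b'"
  shows "prod_encode (a, b) < prod_encode (a', b')"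
proof -
  have mono: "triangle m \<le> triangle n" if "m \<le> n" for m n
    using that by (induction rule: dec_induct) auto
  show ?thesis
  proof (cases "a < a'")
    case True
    with assms(2) mono[of "a + b" "a' + b'"] show ?thesis
      by (simp add: prod_encode_def)
  next
    case False
    with assms have "a = a'" "Suc (a + b) \<le> a' + b'" by auto
    with mono[OF this(2)] show ?thesis
      by (simp add: prod_encode_def)
  qed
qed

lemma prod_encode_mono: "a \<le> a' \<Longrightarrow> b \<le> b' \<Longrightarrow> prod_encode (a, b) \<le> prod_encode (a', b')"
  using prod_encode_strict_mono[of a a' b b'] by (cases "a = a' \<and> b = b'") auto

lemma less_Suc_prod_encode: "n < Suc (prod_encode (a, n))" "n \<le> Suc (prod_encode (a, n))"
  using le_prod_encode_2[of n a] by auto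

lemma semidec_in_range_enc [computable_intros]:
  "computable f \<Longrightarrow> semidec (\<lambda>x. f x \<in> range (enc :: 'a::coded \<Rightarrow> nat))"
  by (rule semidec_vimage[OF semidec_range_enc])

section \<open>Goedel numbers of lists, terms, sequents, rules and derivations\<close>

instantiation list :: (coded) coded
begin
definition enc_list :: "'a list \<Rightarrow> nat" where
  enc_list: "enc_list xs = list_encode (map enc xs)"
instance
proof
  have inj: "inj (enc :: 'a \<Rightarrow> nat)"
    by (rule injI) simp
  show "(enc xs = enc ys) = (xs = ys)" for xs ys :: "'a list"
    by (simp add: enc_list list_encode_eq inj_map_eq_map[OF inj])
  \<comment> \<open>A nonempty list has a single tail, so \<open>a = b\<close> doubles the only
    premise.\<close>
  define T where "T n a b \<longleftrightarrow> (\<exists>c. c \<in> range (enc :: 'a \<Rightarrow> nat) \<and> n = Suc (prod_encode (c, a)) \<and> a = b)"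
    for n a b
  have "semidec (\<lambda>n. n \<in> range (enc :: 'a list \<Rightarrow> nat))"
  proof (rule semidec_rules)
    show "n \<in> range (enc :: 'a list \<Rightarrow> nat) \<longleftrightarrow> n = 0 \<or>
      (\<exists>a b. T n a b \<and> a \<in> range (enc :: 'a list \<Rightarrow> nat) \<and> b \<in> range (enc :: 'a list \<Rightarrow> nat))" for n
    proof
      assume "n \<in> range (enc :: 'a list \<Rightarrow> nat)"
      then obtain xs :: "'a list" where "n = enc xs" by blast
      then show "n = 0 \<or> (\<exists>a b. T n a b \<and> a \<in> range (enc :: 'a list \<Rightarrow> nat) \<and> b \<in> range (enc :: 'a list \<Rightarrow> nat))"
        unfolding T_def by (cases xs) (auto simp: enc_list)
    next
      assume "n = 0 \<or> (\<exists>a b. T n a b \<and> a \<in> range (enc :: 'a list \<Rightarrow> nat) \<and> b \<in> range (enc :: 'a list \<Rightarrow> nat))"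
      then show "n \<in> range (enc :: 'a list \<Rightarrow> nat)"
      proof
        assume "n = 0"
        then have "n = enc ([] :: 'a list)" by (simp add: enc_list)
        then show ?thesis by blast
      next
        assume "\<exists>a b. T n a b \<and> a \<in> range (enc :: 'a list \<Rightarrow> nat) \<and> b \<in> range (enc :: 'a list \<Rightarrow> nat)"
        then obtain x :: 'a and xs :: "'a list" where "n = Suc (prod_encode (enc x, enc xs))"
          by (auto simp: T_def)
        then have "n = enc (x # xs)" by (simp add: enc_list)
        then show ?thesis by blast
      qed
    qed
    show "a < n \<and> b < n" if "T n a b" for n a b
      using that by (auto simp: T_def less_Suc_prod_encode)
  qed (unfold T_def, (intro computable_intros)+)
  then show "semi (\<lambda>n. n \<in> range (enc :: 'a list \<Rightarrow> nat))"
    by (simp add: semidec_iff_semi)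
qed
end

lemma enc_Nil [simp]: "enc [] = 0"
  and enc_Cons [simp]: "enc (x # xs) = Suc (prod_encode (enc x, enc xs))"
  by (simp_all add: enc_list)

lemma computable_Cons [computable_intros]:
  assumes "computable f" and "computable g"
  shows "computable (\<lambda>x. f x # g x)"
  by (rule computable_from_enc) (simp, intro computable_intros assms)

text \<open>Recursion on the first list: \<open>T\<close> removes the common head of the first list
  and of the result, which lowers the code of the tuple.\<close>

lemma computable_append [computable_intros]:
  assumes "computable f" and "computable g"
  shows "computable (\<lambda>x. f x @ g x)"
proof -
  have "computable (\<lambda>z :: 'b list \<times> 'b list. fst z @ snd z)"
    unfolding computable_def
  proof (rule semidec_inductive[where B = "\<lambda>z. fst (fst z) = [] \<and> snd z = snd (fst z)"
      and T = "\<lambda>z z1 z2. \<exists>a as bs. fst (fst z) = a # as \<and> snd z = a # bs \<and>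
        z1 = ((as, snd (fst z)), bs) \<and> z2 = z1"])
    show "snd z = fst (fst z) @ snd (fst z) \<longleftrightarrow> fst (fst z) = [] \<and> snd z = snd (fst z) \<or>
      (\<exists>z1 z2. (\<exists>a as bs. fst (fst z) = a # as \<and> snd z = a # bs \<and> z1 = ((as, snd (fst z)), bs) \<and> z2 = z1) \<and>
        snd z1 = fst (fst z1) @ snd (fst z1) \<and> snd z2 = fst (fst z2) @ snd (fst z2))"
      for z :: "('b list \<times> 'b list) \<times> 'b list"
      by (cases "fst (fst z)") auto
    show "enc z1 < enc z \<and> enc z2 < enc z"
      if "\<exists>a as bs. fst (fst z) = a # as \<and> snd z = a # bs \<and> z1 = ((as, snd (fst z)), bs) \<and> z2 = z1"
      for z z1 z2 :: "('b list \<times> 'b list) \<times> 'b list"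
      using that by (auto intro!: prod_encode_strict_mono prod_encode_mono simp: less_Suc_prod_encode)
  qed (intro computable_intros)+
  from computable_comp[OF this computable_pair[OF assms]] show ?thesis by simp
qed

lemma computable_map:
  fixes h :: "'a::coded \<Rightarrow> 'b::coded"
  assumes h: "computable h" and f: "computable f"
  shows "computable (\<lambda>x. map h (f x))"
proof -
  have "computable (map h)"
    unfolding computable_def
  proof (rule semidec_inductive[where B = "\<lambda>z. fst z = [] \<and> snd z = []"
      and T = "\<lambda>z z1 z2. \<exists>a as bs. fst z = a # as \<and> snd z = h a # bs \<and> z1 = (as, bs) \<and> z2 = z1"])
    show "snd z = map h (fst z) \<longleftrightarrow> fst z = [] \<and> snd z = [] \<or>
      (\<exists>z1 z2. (\<exists>a as bs. fst z = a # as \<and> snd z = h a # bs \<and> z1 = (as, bs) \<and> z2 = z1) \<and>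
        snd z1 = map h (fst z1) \<and> snd z2 = map h (fst z2))" for z
      by (cases "fst z") auto
    show "enc z1 < enc z \<and> enc z2 < enc z"
      if "\<exists>a as bs. fst z = a # as \<and> snd z = h a # bs \<and> z1 = (as, bs) \<and> z2 = z1" for z z1 z2
      using that by (auto intro!: prod_encode_strict_mono prod_encode_mono simp: less_Suc_prod_encode)
  qed (intro computable_intros computable_comp[OF h])+
  from computable_comp[OF this f] show ?thesis .
qed

text \<open>The tags of compound terms are positive, and this makes their codes exceed those of
  their parts; tag 0 would not do, as \<open>prod_encode (0, 0) = 0\<close>.\<close>

lemma less_prod_encode: "0 < k \<Longrightarrow> n < prod_encode (k, n)"
  using prod_encode_strict_mono[of 0 k n n] le_prod_encode_2[of n 0] by simp

instantiation tm :: coded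
begin
definition enc_tm :: "tm \<Rightarrow> nat" where
  [simp]: "enc_tm = tm_code"
instance
proof
  show "(enc s = enc t) = (s = t)" for s t :: tm
    by (simp add: inj_eq[OF inj_tm_code])
  define B where "B n \<longleftrightarrow> (\<exists>i. n = prod_encode (0, i)) \<or> n = prod_encode (1, 0)" for n
  define T where "T n a b \<longleftrightarrow> (\<exists>k. (k = 2 \<or> k = 3 \<or> k = 4 \<or> k = 5 \<or> k = 6) \<and>
    n = prod_encode (k, prod_encode (a, b)))" for n a b
  have "semidec (\<lambda>n. n \<in> range tm_code)"
  proof (rule semidec_rules)
    show "n \<in> range tm_code \<longleftrightarrow> B n \<or> (\<exists>a b. T n a b \<and> a \<in> range tm_code \<and> b \<in> range tm_code)" for n
    proof
      assume "n \<in> range tm_code"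
      then obtain t where "n = tm_code t" by blast
      then show "B n \<or> (\<exists>a b. T n a b \<and> a \<in> range tm_code \<and> b \<in> range tm_code)"
        by (cases t) (auto simp: B_def T_def)
    next
      assume "B n \<or> (\<exists>a b. T n a b \<and> a \<in> range tm_code \<and> b \<in> range tm_code)"
      then consider i where "n = tm_code (Var i)" | "n = tm_code Unit"
        | s t where "T n (tm_code s) (tm_code t)"
        by (auto simp: B_def)
      then show "n \<in> range tm_code"
      proof cases
        case (3 s t)
        then have "n = tm_code (Meet s t) \<or> n = tm_code (Join s t) \<or> n = tm_code (Mult s t) \<or>
          n = tm_code (LDiv s t) \<or> n = tm_code (RDiv s t)"
          by (auto simp: T_def)
        then show ?thesis by blast
      qed blast+
    qed
    show "a < n \<and> b < n" if T: "T n a b" for n a b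
    proof -
      from T obtain k where "0 < k" "n = prod_encode (k, prod_encode (a, b))"
        by (auto simp: T_def)
      then have "prod_encode (a, b) < n"
        by (simp add: less_prod_encode)
      then show ?thesis
        using le_prod_encode_1[of a b] le_prod_encode_2[of b a] by linarith
    qed
    show "semidec B"
      unfolding B_def by (intro computable_intros)
    show "semidec (\<lambda>z. T (fst z) (fst (snd z)) (snd (snd z)))"
      unfolding T_def by (intro computable_intros)
  qed
  then show "semi (\<lambda>n. n \<in> range (enc :: tm \<Rightarrow> nat))"
    by (simp add: semidec_iff_semi)
qed
end

instantiation sequent :: coded
begin
definition enc_sequent :: "sequent \<Rightarrow> nat" where
  "enc_sequent S = enc (antecedent S, succedent S)"
instance
proof
  show "(enc S = enc S') = (S = S')" for S S' :: sequent
    by (cases S; cases S') (simp add: enc_sequent_def del: enc_prod)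
  have "range (enc :: sequent \<Rightarrow> nat) = range (enc :: tm list \<times> tm \<Rightarrow> nat)"
  proof (intro Set.set_eqI iffI)
    fix n assume "n \<in> range (enc :: tm list \<times> tm \<Rightarrow> nat)"
    then obtain z :: "tm list \<times> tm" where "n = enc z" by blast
    then have "n = enc (fst z \<turnstile> snd z)" by (simp add: enc_sequent_def)
    then show "n \<in> range (enc :: sequent \<Rightarrow> nat)" by blast
  next
    fix n assume "n \<in> range (enc :: sequent \<Rightarrow> nat)"
    then obtain S :: sequent where "n = enc S" by blast
    then have "n = enc (antecedent S, succedent S)" by (simp only: enc_sequent_def)
    then show "n \<in> range (enc :: tm list \<times> tm \<Rightarrow> nat)" by blast
  qed
  then show "semi (\<lambda>n. n \<in> range (enc :: sequent \<Rightarrow> nat))"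
    using semi_range_enc[where 'a = "tm list \<times> tm"] by (simp only:)
qed
end

lemma enc_sequent_code: "enc S = sequent_code S"
  by (simp add: enc_sequent_def sequent_code_def enc_list)

instantiation rule :: coded
begin
definition enc_rule :: "rule \<Rightarrow> nat" where
  [simp]: "enc_rule = rule_code"
instance
proof
  show "(enc r = enc r') = (r = r')" for r r' :: rule
    by (simp add: inj_eq[OF inj_rule_code])
  have U: "(UNIV :: rule set) = {Ident, Cut, UnitL, UnitR, RDivL, RDivR, LDivL, LDivR, MultL, MultR,
      MeetL1, MeetL2, MeetR, JoinL, JoinR1, JoinR2, LGWeak}" (is "_ = ?R")
  proof (rule UNIV_eq_I)
    show "r \<in> ?R" for r by (cases r) simp_all
  qed
  have R: "range (enc :: rule \<Rightarrow> nat) = rule_code ` ?R"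
    unfolding enc_rule_def by (rule arg_cong[OF U])
  have "semidec (\<lambda>n. n \<in> range (enc :: rule \<Rightarrow> nat))"
    unfolding R image_insert image_empty insert_iff empty_iff by (intro computable_intros)
  then show "semi (\<lambda>n. n \<in> range (enc :: rule \<Rightarrow> nat))"
    by (simp add: semidec_iff_semi)
qed
end

instantiation deriv :: coded
begin
definition enc_deriv :: "deriv \<Rightarrow> nat" where
  [simp]: "enc_deriv = deriv_code"
instance
proof
  show "(enc d = enc d') = (d = d')" for d d' :: deriv
    by (simp add: inj_eq[OF inj_deriv_code])
  \<comment> \<open>Derivations branch arbitrarily, whereas the inductive scheme allows two
    premises. Forests fit: a nonempty forest splits into the forest above the root of its first tree
    and the remaining forest. A single tree is recovered as a forest of length one.\<close>
  let ?F = "range (\<lambda>ds. list_encode (map deriv_code ds))"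
  define T where "T n a b \<longleftrightarrow> (\<exists>r s. r \<in> range (enc :: rule \<Rightarrow> nat) \<and> s \<in> range (enc :: sequent \<Rightarrow> nat) \<and>
    n = Suc (prod_encode (prod_encode (r, prod_encode (a, s)), b)))" for n a b
  have F: "semidec (\<lambda>n. n \<in> ?F)"
  proof (rule semidec_rules)
    show "n \<in> ?F \<longleftrightarrow> n = 0 \<or> (\<exists>a b. T n a b \<and> a \<in> ?F \<and> b \<in> ?F)" for n
    proof
      assume "n \<in> ?F"
      then obtain ds where n: "n = list_encode (map deriv_code ds)" by blast
      show "n = 0 \<or> (\<exists>a b. T n a b \<and> a \<in> ?F \<and> b \<in> ?F)"
      proof (cases ds)
        case (Cons d ds')
        obtain r es S where d: "d = Infer r es S" by (cases d)
        have "T n (list_encode (map deriv_code es)) (list_encode (map deriv_code ds'))"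
          unfolding T_def using n Cons d
          by (intro exI[of _ "enc r"] exI[of _ "enc S"]) (simp add: enc_sequent_code)
        then show ?thesis by blast
      qed (simp add: n)
    next
      assume "n = 0 \<or> (\<exists>a b. T n a b \<and> a \<in> ?F \<and> b \<in> ?F)"
      then show "n \<in> ?F"
      proof
        assume "n = 0"
        then have "n = list_encode (map deriv_code [])" by simp
        then show ?thesis by blast
      next
        assume "\<exists>a b. T n a b \<and> a \<in> ?F \<and> b \<in> ?F"
        then obtain r :: rule and S :: sequent and es ds where
          "n = Suc (prod_encode (prod_encode (enc r, prod_encode (list_encode (map deriv_code es), enc S)),
            list_encode (map deriv_code ds)))"
          unfolding T_def by blast
        then have "n = list_encode (map deriv_code (Infer r es S # ds))"
          by (simp add: enc_sequent_code)
        then show ?thesis by blast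
      qed
    qed
    show "a < n \<and> b < n" if T: "T n a b" for n a b
    proof -
      from T obtain r s where n: "n = Suc (prod_encode (prod_encode (r, prod_encode (a, s)), b))"
        by (auto simp: T_def)
      have "a \<le> prod_encode (a, s)" "prod_encode (a, s) \<le> prod_encode (r, prod_encode (a, s))"
        "prod_encode (r, prod_encode (a, s)) \<le> prod_encode (prod_encode (r, prod_encode (a, s)), b)"
        "b \<le> prod_encode (prod_encode (r, prod_encode (a, s)), b)"
        by (rule le_prod_encode_1 le_prod_encode_2)+
      then show ?thesis
        unfolding n by linarith
    qed
  qed (unfold T_def, (intro computable_intros)+)
  have "n \<in> range deriv_code \<longleftrightarrow> Suc (prod_encode (n, 0)) \<in> ?F" for n
  proof
    assume "n \<in> range deriv_code"
    then obtain d where "n = deriv_code d" by blast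
    then have "Suc (prod_encode (n, 0)) = list_encode (map deriv_code [d])" by simp
    then show "Suc (prod_encode (n, 0)) \<in> ?F" by blast
  next
    assume "Suc (prod_encode (n, 0)) \<in> ?F"
    then obtain ds where "Suc (prod_encode (n, 0)) = list_encode (map deriv_code ds)" by blast
    then show "n \<in> range deriv_code" by (cases ds) auto
  qed
  moreover have "semidec (\<lambda>n. Suc (prod_encode (n, 0)) \<in> ?F)"
    by (rule semidec_vimage[OF F]) (intro computable_intros)
  ultimately show "semi (\<lambda>n. n \<in> range (enc :: deriv \<Rightarrow> nat))"
    by (simp add: semidec_iff_semi)
qed
end

lemma enc_Infer: "enc (Infer r ds S) = prod_encode (enc r, prod_encode (enc ds, enc S))"
  by (simp add: enc_list enc_sequent_code)

text \<open>Well-foundedness of the splitting of forests, for recursions over derivations.\<close>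

lemma enc_premises_less:
  "enc ds < enc (Infer r ds S # ds')" "enc ds' < enc (Infer r ds S # ds')"
proof -
  have "enc ds \<le> prod_encode (enc ds, enc S)"
    "prod_encode (enc ds, enc S) \<le> enc (Infer r ds S)"
    "enc (Infer r ds S) \<le> prod_encode (enc (Infer r ds S), enc ds')"
    "enc ds' \<le> prod_encode (enc (Infer r ds S), enc ds')"
    unfolding enc_Infer by (rule le_prod_encode_1 le_prod_encode_2)+
  then show "enc ds < enc (Infer r ds S # ds')" "enc ds' < enc (Infer r ds S # ds')"
    unfolding enc_Cons by linarith+
qed

lemma computable_constructors [computable_intros]:
  assumes "computable f" and "computable g"
  shows "computable (\<lambda>x. Meet (f x) (g x))" and "computable (\<lambda>x. Join (f x) (g x))"
    and "computable (\<lambda>x. Mult (f x) (g x))" and "computable (\<lambda>x. LDiv (f x) (g x))"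
    and "computable (\<lambda>x. RDiv (f x) (g x))"
proof -
  have "computable (\<lambda>x. prod_encode (k, prod_encode (enc (f x), enc (g x))))" for k
    by (intro computable_intros assms)
  note * = this[unfolded enc_tm_def]
  show "computable (\<lambda>x. Meet (f x) (g x))" "computable (\<lambda>x. Join (f x) (g x))"
    "computable (\<lambda>x. Mult (f x) (g x))" "computable (\<lambda>x. LDiv (f x) (g x))"
    "computable (\<lambda>x. RDiv (f x) (g x))"
    by (rule computable_from_enc, unfold enc_tm_def tm_code.simps, rule *)+
qed

lemma computable_Sequent [computable_intros]:
  assumes "computable f" and "computable g"
  shows "computable (\<lambda>x. f x \<turnstile> g x)"
proof (rule computable_from_enc)
  show "computable (\<lambda>x. enc (f x \<turnstile> g x))"
    using computable_enc[OF computable_pair[OF assms]] by (simp only: enc_sequent_def sequent.sel)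
qed

lemma computable_Infer [computable_intros]:
  assumes "computable f" and "computable g" and "computable h"
  shows "computable (\<lambda>x. Infer (f x) (g x) (h x))"
  by (rule computable_from_enc, unfold enc_Infer) (intro computable_intros assms)

lemma computable_conclusion [computable_intros]:
  assumes "computable f"
  shows "computable (\<lambda>x. conclusion (f x))"
proof -
  have "conclusion d = S \<longleftrightarrow> (\<exists>r ds. d = Infer r ds S)" for d S
    by (cases d) auto
  then have eq: "S = conclusion d \<longleftrightarrow> (\<exists>r ds. d = Infer r ds S)" for d S
    by metis
  have "computable conclusion"
    unfolding computable_def eq by (intro computable_intros)
  from computable_comp[OF this assms] show ?thesis .
qed

section \<open>Semidecidability of derivations relative to a set of weakening sequences\<close>

text \<open>The semantic side condition becomes a parameter \<open>V\<close>, so that it can be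
  instantiated by a semidecidable set, and \<open>c\<close> tells whether cut is allowed.\<close>

definition step :: "bool \<Rightarrow> (tm list \<Rightarrow> bool) \<Rightarrow> rule \<Rightarrow> sequent list \<Rightarrow> sequent \<Rightarrow> bool" where
  "step c V r Ps S \<longleftrightarrow>
     r \<noteq> LGWeak \<and> (r = Cut \<longrightarrow> c) \<and> rule_instance r Ps S \<or>
     r = LGWeak \<and> (\<exists>\<Gamma> \<Delta> \<Theta> u. V \<Delta> \<and> Ps = [\<Gamma> @ \<Theta> \<turnstile> u] \<and> S = (\<Gamma> @ \<Delta> @ \<Theta> \<turnstile> u))"

fun follows :: "bool \<Rightarrow> (tm list \<Rightarrow> bool) \<Rightarrow> deriv \<Rightarrow> bool" where
  "follows c V (Infer r ds S) \<longleftrightarrow>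
     step c V r (map conclusion ds) S \<and> (\<forall>d \<in> set ds. follows c V d)"

text \<open>All readings of a weakening step are collected, since the tree does not fix one: the
  step from \<open>[a]\<close> to \<open>[a, b, a]\<close> may insert \<open>[a, b]\<close> or
  \<open>[b, a]\<close>.\<close>

fun weakens_by :: "deriv \<Rightarrow> tm list \<Rightarrow> bool" where
  "weakens_by (Infer r ds S) \<Delta> \<longleftrightarrow>
     r = LGWeak \<and> (\<exists>\<Gamma> \<Theta> u. map conclusion ds = [\<Gamma> @ \<Theta> \<turnstile> u] \<and> S = (\<Gamma> @ \<Delta> @ \<Theta> \<turnstile> u)) \<or>
     (\<exists>d \<in> set ds. weakens_by d \<Delta>)"

text \<open>Codes are numbers, whose equality is decidable, so inequality is again the vanishing of
  a recursive function. It is needed to exclude \<open>LGWeak\<close> and \<open>Cut\<close> in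
  \<open>step\<close>.\<close>

lemma semidec_neq [computable_intros]:
  assumes "computable f" and "computable g"
  shows "semidec (\<lambda>x. f x \<noteq> g x)"
proof -
  let ?a = "\<lambda>z. fst (prod_decode z)" and ?b = "\<lambda>z. snd (prod_decode z)"
  have "recursive_fun (\<lambda>z. 1 - ((?a z - ?b z) + (?b z - ?a z)))"
    using recursive_fst recursive_snd unfolding recursive_fun_def
    by (intro total_recursive_add total_recursive_diff total_recursive_const)
  from semi_eq_0[OF this] have "semidec (\<lambda>z. 1 - ((?a z - ?b z) + (?b z - ?a z)) = 0)"
    by (simp only: semidec_iff_semi)
  from semidec_vimage[OF this computable_prod_encode[OF assms[THEN computable_enc]]]
  have "semidec (\<lambda>x. 1 - ((enc (f x) - enc (g x)) + (enc (g x) - enc (f x))) = 0)"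
    by simp
  moreover have "1 - ((enc (f x) - enc (g x)) + (enc (g x) - enc (f x))) = 0 \<longleftrightarrow> f x \<noteq> g x" for x
  proof -
    have "1 - ((enc (f x) - enc (g x)) + (enc (g x) - enc (f x))) = 0 \<longleftrightarrow> enc (f x) \<noteq> enc (g x)"
    proof -
      have "1 - ((a - b) + (b - a)) = 0 \<longleftrightarrow> a \<noteq> b" for a b :: nat
        by arith
      then show ?thesis .
    qed
    then show ?thesis by simp
  qed
  ultimately show ?thesis by (simp only:)
qed

text \<open>\<open>V\<close> carries an extra argument because the weakening set will depend on the
  derivation given as input.\<close>

lemma semidec_step:
  assumes V: "semidec (\<lambda>z. V (fst z) (snd z))"
    and "computable e" "computable r" "computable Ps" "computable S"
  shows "semidec (\<lambda>x. step c (V (e x)) (r x) (Ps x) (S x))"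
proof -
  have "semidec (\<lambda>z. step c (V (fst z)) (fst (snd z)) (fst (snd (snd z))) (snd (snd (snd z))))"
    \<comment> \<open>The rules become a disjunction of existentially quantified equations. The
      disjunct mentioning \<open>LG_valid\<close> contradicts \<open>r \<noteq> LGWeak\<close> and
      is simplified away, so no semidecidability of validity is required.\<close>
    unfolding step_def rule_instance.simps
    by (cases c; simp add: conj_disj_distribL cong: conj_cong)
      (intro computable_intros semidec_vimage2[OF V])+
  from semidec_vimage[OF this, of "\<lambda>x. (e x, r x, Ps x, S x)"] show ?thesis
    by (simp add: computable_intros assms(2-))
qed

text \<open>Recursion over forests: the root of the first tree is checked locally, and both smaller
  forests must pass.\<close>

lemma semidec_follows:
  assumes V: "semidec (\<lambda>z. V (fst z) (snd z))" and "computable e" "computable f"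
  shows "semidec (\<lambda>x. follows c (V (e x)) (f x))"
proof -
  have "semidec (\<lambda>z. \<forall>d\<in>set (snd z). follows c (V (fst z)) d)"
  proof (rule semidec_inductive[where B = "\<lambda>z. snd z = []" and T = "\<lambda>z z1 z2. \<exists>r ds S ds'.
      snd z = Infer r ds S # ds' \<and> step c (V (fst z)) r (map conclusion ds) S \<and>
      z1 = (fst z, ds) \<and> z2 = (fst z, ds')"])
    show "(\<forall>d\<in>set (snd z). follows c (V (fst z)) d) \<longleftrightarrow> snd z = [] \<or>
      (\<exists>z1 z2. (\<exists>r ds S ds'. snd z = Infer r ds S # ds' \<and>
         step c (V (fst z)) r (map conclusion ds) S \<and> z1 = (fst z, ds) \<and> z2 = (fst z, ds')) \<and>
       (\<forall>d\<in>set (snd z1). follows c (V (fst z1)) d) \<and> (\<forall>d\<in>set (snd z2). follows c (V (fst z2)) d))" for z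
    proof (cases "snd z")
      case (Cons d ds')
      then show ?thesis by (cases d) auto
    qed simp
    show "enc z1 < enc z \<and> enc z2 < enc z"
      if T: "\<exists>r ds S ds'. snd z = Infer r ds S # ds' \<and>
         step c (V (fst z)) r (map conclusion ds) S \<and> z1 = (fst z, ds) \<and> z2 = (fst z, ds')" for z z1 z2
    proof -
      from T obtain r ds S ds' where "snd z = Infer r ds S # ds'" "z1 = (fst z, ds)" "z2 = (fst z, ds')"
        by blast
      then show ?thesis
        using enc_premises_less[where ds = ds and r = r and S = S and ds' = ds'] by (simp add: prod_encode_strict_mono del: enc_Cons)
    qed
  qed (intro computable_intros computable_map semidec_step[OF V])+
  from semidec_vimage[OF this, of "\<lambda>x. (e x, [f x])"] show ?thesis
    by (simp add: computable_intros assms(2,3))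
qed

text \<open>As the property is existential, \<open>?T\<close> chooses one of the two smaller forests
  and uses it as both premises.\<close>

lemma semidec_weakens_by: "semidec (\<lambda>z. weakens_by (fst z) (snd z))"
proof -
  let ?B = "\<lambda>z. \<exists>r ds S ds'. snd z = Infer r ds S # ds' \<and> r = LGWeak \<and>
    (\<exists>\<Gamma> \<Theta> u. map conclusion ds = [\<Gamma> @ \<Theta> \<turnstile> u] \<and> S = (\<Gamma> @ fst z @ \<Theta> \<turnstile> u))"
  let ?T = "\<lambda>z z1 z2. \<exists>r ds S ds'. snd z = Infer r ds S # ds' \<and>
    (z1 = (fst z, ds) \<or> z1 = (fst z, ds')) \<and> z2 = z1"
  have "semidec (\<lambda>z. \<exists>d\<in>set (snd z). weakens_by d (fst z))"
  proof (rule semidec_inductive[where B = ?B and T = ?T])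
    show "(\<exists>d\<in>set (snd z). weakens_by d (fst z)) \<longleftrightarrow> ?B z \<or>
      (\<exists>z1 z2. ?T z z1 z2 \<and> (\<exists>d\<in>set (snd z1). weakens_by d (fst z1)) \<and>
        (\<exists>d\<in>set (snd z2). weakens_by d (fst z2)))" for z
    proof (cases "snd z")
      case (Cons d ds')
      obtain r ds S where d: "d = Infer r ds S" by (cases d)
      have "?T z z1 z2 \<longleftrightarrow> (z1 = (fst z, ds) \<or> z1 = (fst z, ds')) \<and> z2 = z1" for z1 z2
        by (auto simp: Cons d)
      then have "(\<exists>z1 z2. ?T z z1 z2 \<and> (\<exists>d\<in>set (snd z1). weakens_by d (fst z1)) \<and>
          (\<exists>d\<in>set (snd z2). weakens_by d (fst z2))) \<longleftrightarrow>
        (\<exists>d\<in>set ds. weakens_by d (fst z)) \<or> (\<exists>d\<in>set ds'. weakens_by d (fst z))"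
        by (simp only: conj_disj_distribR ex_disj_distrib) auto
      then show ?thesis by (simp only:) (auto simp: Cons d)
    qed simp
    show "enc z1 < enc z \<and> enc z2 < enc z" if T: "?T z z1 z2" for z z1 z2
    proof -
      from T obtain r ds S ds' where "snd z = Infer r ds S # ds'"
        "z1 = (fst z, ds) \<or> z1 = (fst z, ds')" "z2 = z1"
        by blast
      then show ?thesis
        using enc_premises_less[where ds = ds and r = r and S = S and ds' = ds'] by (auto simp: prod_encode_strict_mono simp del: enc_Cons)
    qed
  qed (intro computable_intros computable_map)+
  from semidec_vimage[OF this, of "\<lambda>z. (snd z, [fst z])"] show ?thesis
    by (simp add: computable_intros)
qed

text \<open>The relation to be searched, with the input in \<open>fst z\<close> and the output in
  \<open>snd z\<close>. The inner \<open>follows\<close> is semidecidable, hence so is the existence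
  of a certificate \<open>c\<close>, which then serves as the weakening set of the outer
  one.\<close>

lemma semidec_conclusion_follows:
  "semidec (\<lambda>z. conclusion (snd z) = conclusion (fst z) \<and>
    follows False (\<lambda>\<Delta>. \<exists>c. conclusion c = (\<Delta> \<turnstile> Unit) \<and> follows True (weakens_by (fst z)) c) (snd z))"
  by (intro computable_intros semidec_follows[where V = "\<lambda>d \<Delta>. \<exists>c. conclusion c = (\<Delta> \<turnstile> Unit) \<and>
      follows True (weakens_by d) c"] semidec_follows[OF semidec_weakens_by])

section \<open>Cut elimination relative to a set of weakening sequences\<close>

text \<open>Derivability without trees, equivalent to the existence of a tree satisfying
  \<open>follows\<close>; it gives plain rule induction for cut elimination.\<close>

inductive derives :: "bool \<Rightarrow> (tm list \<Rightarrow> bool) \<Rightarrow> tm list \<Rightarrow> tm \<Rightarrow> bool"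
  for c :: bool and V :: "tm list \<Rightarrow> bool" where
  Ident: "derives c V [s] s"
| Cut: "c \<Longrightarrow> derives c V \<Gamma>2 s \<Longrightarrow> derives c V (\<Gamma>1 @ [s] @ \<Gamma>3) u \<Longrightarrow>
    derives c V (\<Gamma>1 @ \<Gamma>2 @ \<Gamma>3) u"
| UnitL: "derives c V (\<Gamma>1 @ \<Gamma>2) u \<Longrightarrow> derives c V (\<Gamma>1 @ [Unit] @ \<Gamma>2) u"
| UnitR: "derives c V [] Unit"
| RDivL: "derives c V \<Gamma>2 s \<Longrightarrow> derives c V (\<Gamma>1 @ [t] @ \<Gamma>3) u \<Longrightarrow>
    derives c V (\<Gamma>1 @ [RDiv t s] @ \<Gamma>2 @ \<Gamma>3) u"
| RDivR: "derives c V (\<Gamma> @ [s]) t \<Longrightarrow> derives c V \<Gamma> (RDiv t s)"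
| LDivL: "derives c V \<Gamma>2 s \<Longrightarrow> derives c V (\<Gamma>1 @ [t] @ \<Gamma>3) u \<Longrightarrow>
    derives c V (\<Gamma>1 @ \<Gamma>2 @ [LDiv s t] @ \<Gamma>3) u"
| LDivR: "derives c V ([s] @ \<Gamma>) t \<Longrightarrow> derives c V \<Gamma> (LDiv s t)"
| MultL: "derives c V (\<Gamma>1 @ [s, t] @ \<Gamma>2) u \<Longrightarrow> derives c V (\<Gamma>1 @ [Mult s t] @ \<Gamma>2) u"
| MultR: "derives c V \<Gamma>1 s \<Longrightarrow> derives c V \<Gamma>2 t \<Longrightarrow> derives c V (\<Gamma>1 @ \<Gamma>2) (Mult s t)"
| MeetL1: "derives c V (\<Gamma>1 @ [s] @ \<Gamma>2) u \<Longrightarrow> derives c V (\<Gamma>1 @ [Meet s t] @ \<Gamma>2) u"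
| MeetL2: "derives c V (\<Gamma>1 @ [t] @ \<Gamma>2) u \<Longrightarrow> derives c V (\<Gamma>1 @ [Meet s t] @ \<Gamma>2) u"
| MeetR: "derives c V \<Gamma> s \<Longrightarrow> derives c V \<Gamma> t \<Longrightarrow> derives c V \<Gamma> (Meet s t)"
| JoinL: "derives c V (\<Gamma>1 @ [s] @ \<Gamma>2) u \<Longrightarrow> derives c V (\<Gamma>1 @ [t] @ \<Gamma>2) u \<Longrightarrow>
    derives c V (\<Gamma>1 @ [Join s t] @ \<Gamma>2) u"
| JoinR1: "derives c V \<Gamma> s \<Longrightarrow> derives c V \<Gamma> (Join s t)"
| JoinR2: "derives c V \<Gamma> t \<Longrightarrow> derives c V \<Gamma> (Join s t)"
| Weak: "V \<Delta> \<Longrightarrow> derives c V (\<Gamma> @ \<Theta>) u \<Longrightarrow> derives c V (\<Gamma> @ \<Delta> @ \<Theta>) u"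

lemma derives_mono:
  assumes "derives c V \<Gamma> u" and "\<And>\<Delta>. V \<Delta> \<Longrightarrow> V' \<Delta>"
  shows "derives c V' \<Gamma> u"
  using assms(1) by induction (rule derives.intros; (assumption | rule assms(2), assumption))+

text \<open>What the right rule for the outermost symbol of a cut formula has as premises. Variables
  have no right rule, and for \<open>Unit\<close> the rule is the axiom.\<close>

fun right_premises :: "(tm list \<Rightarrow> bool) \<Rightarrow> tm list \<Rightarrow> tm \<Rightarrow> bool" where
  "right_premises V \<Gamma> (Var i) \<longleftrightarrow> False"
| "right_premises V \<Gamma> Unit \<longleftrightarrow> \<Gamma> = []"
| "right_premises V \<Gamma> (Meet s t) \<longleftrightarrow> derives False V \<Gamma> s \<and> derives False V \<Gamma> t"
| "right_premises V \<Gamma> (Join s t) \<longleftrightarrow> derives False V \<Gamma> s \<or> derives False V \<Gamma> t"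
| "right_premises V \<Gamma> (Mult s t) \<longleftrightarrow>
     (\<exists>\<Gamma>1 \<Gamma>2. \<Gamma> = \<Gamma>1 @ \<Gamma>2 \<and> derives False V \<Gamma>1 s \<and> derives False V \<Gamma>2 t)"
| "right_premises V \<Gamma> (LDiv s t) \<longleftrightarrow> derives False V ([s] @ \<Gamma>) t"
| "right_premises V \<Gamma> (RDiv t s) \<longleftrightarrow> derives False V (\<Gamma> @ [s]) t"

text \<open>The left rules and weakening permute below a cut from the left, so that only identity and
  the right rules remain to be considered.\<close>

lemma cut_right_reduction:
  assumes "derives False V \<Gamma> s" and "derives False V (L @ [s] @ R) u"
    and "\<And>\<Gamma>. right_premises V \<Gamma> s \<Longrightarrow> derives False V (L @ \<Gamma> @ R) u"
  shows "derives False V (L @ \<Gamma> @ R) u"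
  using assms
proof induction
  case (UnitL \<Gamma>1 \<Gamma>2 s)
  then have "derives False V ((L @ \<Gamma>1) @ (\<Gamma>2 @ R)) u" by simp
  from derives.UnitL[OF this] show ?case by simp
next
  case (RDivL \<Gamma>2 s \<Gamma>1 t \<Gamma>3 u')
  then have "derives False V ((L @ \<Gamma>1) @ [t] @ (\<Gamma>3 @ R)) u" by simp
  from derives.RDivL[OF RDivL.hyps(1) this] show ?case by simp
next
  case (LDivL \<Gamma>2 s \<Gamma>1 t \<Gamma>3 u')
  then have "derives False V ((L @ \<Gamma>1) @ [t] @ (\<Gamma>3 @ R)) u" by simp
  from derives.LDivL[OF LDivL.hyps(1) this] show ?case by simp
next
  case (MultL \<Gamma>1 s t \<Gamma>2 u')
  then have "derives False V ((L @ \<Gamma>1) @ [s, t] @ (\<Gamma>2 @ R)) u" by simp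
  from derives.MultL[OF this] show ?case by simp
next
  case (MeetL1 \<Gamma>1 s \<Gamma>2 u' t)
  then have "derives False V ((L @ \<Gamma>1) @ [s] @ (\<Gamma>2 @ R)) u" by simp
  from derives.MeetL1[OF this] show ?case by simp
next
  case (MeetL2 \<Gamma>1 t \<Gamma>2 u' s)
  then have "derives False V ((L @ \<Gamma>1) @ [t] @ (\<Gamma>2 @ R)) u" by simp
  from derives.MeetL2[OF this] show ?case by simp
next
  case (JoinL \<Gamma>1 s \<Gamma>2 u' t)
  then have "derives False V ((L @ \<Gamma>1) @ [s] @ (\<Gamma>2 @ R)) u"
    "derives False V ((L @ \<Gamma>1) @ [t] @ (\<Gamma>2 @ R)) u" by simp_all
  from derives.JoinL[OF this] show ?case by simp
next
  case (Weak \<Delta> \<Gamma> \<Theta> u')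
  then have "derives False V ((L @ \<Gamma>) @ (\<Theta> @ R)) u" by simp
  from derives.Weak[OF Weak.hyps(1) this] show ?case by simp
next
  case (MultR \<Gamma>1 s \<Gamma>2 t)
  then show ?case by (metis right_premises.simps(5))
next
  case UnitR
  then show ?case by (metis right_premises.simps(2))
qed auto

text \<open>Cutting several occurrences of \<open>s\<close> at once keeps the case analysis of the last rule uniform, as
  replacement distributes over concatenation.\<close>

inductive replaces :: "(tm list \<Rightarrow> bool) \<Rightarrow> tm \<Rightarrow> tm list \<Rightarrow> tm list \<Rightarrow> bool"
  for V :: "tm list \<Rightarrow> bool" and s :: tm where
  replaces_Nil: "replaces V s [] []"
| replaces_keep: "replaces V s \<Gamma> \<Gamma>' \<Longrightarrow> replaces V s (t # \<Gamma>) (t # \<Gamma>')"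
| replaces_subst: "derives False V \<Delta> s \<Longrightarrow> replaces V s \<Gamma> \<Gamma>' \<Longrightarrow> replaces V s (s # \<Gamma>) (\<Delta> @ \<Gamma>')"

lemma replaces_refl: "replaces V s \<Gamma> \<Gamma>"
  by (induction \<Gamma>) (auto intro: replaces.intros)

lemma replaces_append:
  "replaces V s \<Gamma>1 \<Gamma>1' \<Longrightarrow> replaces V s \<Gamma>2 \<Gamma>2' \<Longrightarrow> replaces V s (\<Gamma>1 @ \<Gamma>2) (\<Gamma>1' @ \<Gamma>2')"
  by (induction rule: replaces.induct) (auto intro: replaces.intros)

lemma replaces_Nil_iff [simp]: "replaces V s [] \<Gamma> \<longleftrightarrow> \<Gamma> = []"
  by (auto intro: replaces.intros elim: replaces.cases)

lemma replaces_appendE: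
  assumes "replaces V s (\<Gamma>1 @ \<Gamma>2) \<Gamma>"
  obtains \<Gamma>1' \<Gamma>2' where "\<Gamma> = \<Gamma>1' @ \<Gamma>2'" "replaces V s \<Gamma>1 \<Gamma>1'" "replaces V s \<Gamma>2 \<Gamma>2'"
  using assms
proof (induction "\<Gamma>1 @ \<Gamma>2" \<Gamma> arbitrary: \<Gamma>1 \<Gamma>2 thesis rule: replaces.induct)
  case (replaces_keep \<Gamma> \<Gamma>' t)
  show ?case
  proof (cases \<Gamma>1)
    case Nil
    then show ?thesis
      using replaces_keep by (metis append_Nil replaces.replaces_keep replaces_Nil_iff)
  next
    case (Cons x xs)
    then obtain A B where "\<Gamma>' = A @ B" "replaces V s xs A" "replaces V s \<Gamma>2 B"
      using replaces_keep by (metis append_Cons list.inject)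
    then show ?thesis
      using replaces_keep Cons by (metis append_Cons list.inject replaces.replaces_keep)
  qed
next
  case (replaces_subst \<Delta> \<Gamma> \<Gamma>')
  show ?case
  proof (cases \<Gamma>1)
    case Nil
    then show ?thesis
      using replaces_subst by (metis append_Nil replaces.replaces_subst replaces_Nil_iff)
  next
    case (Cons x xs)
    then obtain A B where "\<Gamma>' = A @ B" "replaces V s xs A" "replaces V s \<Gamma>2 B"
      using replaces_subst by (metis append_Cons list.inject)
    then show ?thesis
      using replaces_subst Cons by (metis append_Cons append_assoc list.inject replaces.replaces_subst)
  qed
qed auto

lemma replaces_singleE:
  assumes "replaces V s [t] \<Gamma>"
  obtains "\<Gamma> = [t]" | "t = s" "derives False V \<Gamma> s"
  using assms by cases auto

text \<open>Occurrences are replaced from left to right; \<open>\<Phi>\<close> holds the part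
  already treated, so each replacement is one use of \<open>closed\<close>.\<close>

lemma replaces_closed:
  assumes "replaces V s \<Delta> \<Delta>'" and "V (\<Phi> @ \<Delta>)"
    and closed: "\<And>\<Delta>1 \<Delta>2 \<Gamma>. V (\<Delta>1 @ [s] @ \<Delta>2) \<Longrightarrow> derives False V \<Gamma> s \<Longrightarrow> V (\<Delta>1 @ \<Gamma> @ \<Delta>2)"
  shows "V (\<Phi> @ \<Delta>')"
  using assms(1,2)
proof (induction arbitrary: \<Phi>)
  case (replaces_keep \<Gamma> \<Gamma>' t)
  from replaces_keep.IH[of "\<Phi> @ [t]"] replaces_keep.prems show ?case by simp
next
  case (replaces_subst \<Delta> \<Gamma> \<Gamma>')
  have "V (\<Phi> @ \<Delta> @ \<Gamma>)"
    using closed[of \<Phi> \<Gamma> \<Delta>] replaces_subst.prems replaces_subst.hyps(1) by simp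
  with replaces_subst.IH[of "\<Phi> @ \<Delta>"] show ?case by simp
qed simp

text \<open>Induction on the right premise of the cut. If the active formula of a left rule is kept,
  the rule is reapplied. If it is replaced, \<open>cut_right_reduction\<close> reduces to the case
  where its replacement comes from a right rule, and cuts on immediate subformulas remain, available
  through \<open>smaller\<close>.\<close>

lemma replaces_derives:
  assumes "derives False V \<Xi> u" and "replaces V s \<Xi> \<Xi>'"
    and smaller: "\<And>s' L R \<Gamma> u. size s' < size s \<Longrightarrow> derives False V \<Gamma> s' \<Longrightarrow>
      derives False V (L @ [s'] @ R) u \<Longrightarrow> derives False V (L @ \<Gamma> @ R) u"
    and closed: "\<And>\<Delta>1 \<Delta>2 \<Gamma>. V (\<Delta>1 @ [s] @ \<Delta>2) \<Longrightarrow> derives False V \<Gamma> s \<Longrightarrow> V (\<Delta>1 @ \<Gamma> @ \<Delta>2)"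
  shows "derives False V \<Xi>' u"
  using assms(1,2)
proof (induction arbitrary: \<Xi>')
  case (Ident t)
  from Ident.prems show ?case
    by (cases rule: replaces_singleE) (auto intro: derives.Ident)
next
  case (UnitL \<Gamma>1 \<Gamma>2 u)
  from UnitL.prems obtain L X R where \<Xi>': "\<Xi>' = L @ X @ R"
    and r: "replaces V s \<Gamma>1 L" "replaces V s [Unit] X" "replaces V s \<Gamma>2 R"
    by (elim replaces_appendE) blast
  have *: "derives False V (L @ R) u"
    by (intro UnitL.IH replaces_append r)
  note 3 = derives.UnitL[OF *]
  from r(2) have "derives False V (L @ X @ R) u"
  proof (cases rule: replaces_singleE)
    case 2
    from 2(2) show ?thesis
      by (rule cut_right_reduction) (use * 2(1) 3 in auto)
  qed (use 3 in auto)
  then show ?case by (simp add: \<Xi>')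
next
  case (RDivL \<Gamma>2 a \<Gamma>1 b \<Gamma>3 u)
  from RDivL.prems obtain L X Y R where \<Xi>': "\<Xi>' = L @ X @ Y @ R"
    and r: "replaces V s \<Gamma>1 L" "replaces V s [RDiv b a] X" "replaces V s \<Gamma>2 Y" "replaces V s \<Gamma>3 R"
    by (elim replaces_appendE) blast
  have 1: "derives False V Y a"
    by (intro RDivL.IH r)
  have 2: "derives False V (L @ [b] @ R) u"
    by (intro RDivL.IH replaces_append replaces_refl r)
  note 3 = derives.RDivL[OF 1 2]
  from r(2) have "derives False V (L @ X @ Y @ R) u"
  proof (cases rule: replaces_singleE)
    case 2
    from 2(2) show ?thesis
    proof (rule cut_right_reduction)
      fix \<Gamma> assume "right_premises V \<Gamma> s"
      then have "derives False V (\<Gamma> @ [a] @ []) b"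
        using 2(1) by auto
      \<comment> \<open>First a cut on the denominator \<open>a\<close>, then one on the numerator
        \<open>b\<close>; the case of \<open>LDiv\<close> is the mirror image.\<close>
      then have yb: "derives False V (\<Gamma> @ Y @ []) b"
        by (rule smaller[rotated 2]) (use 1 2(1) in auto)
      have "derives False V (L @ (\<Gamma> @ Y) @ R) u"
        by (rule smaller[of b]) (use yb \<open>derives False V (L @ [b] @ R) u\<close> 2(1) in auto)
      then show "derives False V (L @ \<Gamma> @ Y @ R) u" by simp
    qed (use 3 2(1) in auto)
  qed (use 3 in auto)
  then show ?case by (simp add: \<Xi>')
next
  case (LDivL \<Gamma>2 a \<Gamma>1 b \<Gamma>3 u)
  from LDivL.prems obtain L X Y R where \<Xi>': "\<Xi>' = L @ Y @ X @ R"
    and r: "replaces V s \<Gamma>1 L" "replaces V s [LDiv a b] X" "replaces V s \<Gamma>2 Y" "replaces V s \<Gamma>3 R"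
    by (elim replaces_appendE) blast
  have 1: "derives False V Y a"
    by (intro LDivL.IH r)
  have 2: "derives False V (L @ [b] @ R) u"
    by (intro LDivL.IH replaces_append replaces_refl r)
  note 3 = derives.LDivL[OF 1 2]
  from r(2) have "derives False V (L @ Y @ X @ R) u"
  proof (cases rule: replaces_singleE)
    case 2
    from 2(2) have "derives False V ((L @ Y) @ X @ R) u"
    proof (rule cut_right_reduction)
      fix \<Gamma> assume "right_premises V \<Gamma> s"
      then have "derives False V ([] @ [a] @ \<Gamma>) b"
        using 2(1) by auto
      then have yb: "derives False V ([] @ Y @ \<Gamma>) b"
        by (rule smaller[rotated 2]) (use 1 2(1) in auto)
      have "derives False V (L @ (Y @ \<Gamma>) @ R) u"
        by (rule smaller[of b]) (use yb \<open>derives False V (L @ [b] @ R) u\<close> 2(1) in auto)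
      then show "derives False V ((L @ Y) @ \<Gamma> @ R) u" by simp
    qed (use 3 2(1) in auto)
    then show ?thesis by simp
  qed (use 3 in auto)
  then show ?case by (simp add: \<Xi>')
next
  case (MultL \<Gamma>1 a b \<Gamma>2 u)
  from MultL.prems obtain L X R where \<Xi>': "\<Xi>' = L @ X @ R"
    and r: "replaces V s \<Gamma>1 L" "replaces V s [Mult a b] X" "replaces V s \<Gamma>2 R"
    by (elim replaces_appendE) blast
  have 1: "derives False V (L @ [a, b] @ R) u"
    by (intro MultL.IH replaces_append replaces_refl r)
  note 3 = derives.MultL[OF 1]
  from r(2) have "derives False V (L @ X @ R) u"
  proof (cases rule: replaces_singleE)
    case 2
    from 2(2) show ?thesis
    proof (rule cut_right_reduction)
      fix \<Gamma> assume "right_premises V \<Gamma> s"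
      then obtain A B where AB: "\<Gamma> = A @ B" "derives False V A a" "derives False V B b"
        using 2(1) by auto
      have ab: "derives False V (L @ A @ ([b] @ R)) u"
        by (rule smaller[of a]) (use AB 1 2(1) in auto)
      have "derives False V ((L @ A) @ B @ R) u"
        by (rule smaller[of b]) (use ab AB 2(1) in auto)
      then show "derives False V (L @ \<Gamma> @ R) u" by (simp add: AB)
    qed (use 3 2(1) in auto)
  qed (use 3 in auto)
  then show ?case by (simp add: \<Xi>')
next
  case (MeetL1 \<Gamma>1 a \<Gamma>2 u b)
  from MeetL1.prems obtain L X R where \<Xi>': "\<Xi>' = L @ X @ R"
    and r: "replaces V s \<Gamma>1 L" "replaces V s [Meet a b] X" "replaces V s \<Gamma>2 R"
    by (elim replaces_appendE) blast
  have 1: "derives False V (L @ [a] @ R) u"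
    by (intro MeetL1.IH replaces_append replaces_refl r)
  note 3 = derives.MeetL1[OF 1, where t = b]
  from r(2) have "derives False V (L @ X @ R) u"
  proof (cases rule: replaces_singleE)
    case 2
    have red: "derives False V (L @ \<Gamma> @ R) u" if "right_premises V \<Gamma> s" for \<Gamma>
      by (rule smaller[of a]) (use 1 2(1) that in auto)
    from 2(2) show ?thesis
      by (rule cut_right_reduction) (use 3 2(1) in simp, rule red)
  qed (use 3 in auto)
  then show ?case by (simp add: \<Xi>')
next
  case (MeetL2 \<Gamma>1 b \<Gamma>2 u a)
  from MeetL2.prems obtain L X R where \<Xi>': "\<Xi>' = L @ X @ R"
    and r: "replaces V s \<Gamma>1 L" "replaces V s [Meet a b] X" "replaces V s \<Gamma>2 R"
    by (elim replaces_appendE) blast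
  have 1: "derives False V (L @ [b] @ R) u"
    by (intro MeetL2.IH replaces_append replaces_refl r)
  note 3 = derives.MeetL2[OF 1, where s = a]
  from r(2) have "derives False V (L @ X @ R) u"
  proof (cases rule: replaces_singleE)
    case 2
    have red: "derives False V (L @ \<Gamma> @ R) u" if "right_premises V \<Gamma> s" for \<Gamma>
      by (rule smaller[of b]) (use 1 2(1) that in auto)
    from 2(2) show ?thesis
      by (rule cut_right_reduction) (use 3 2(1) in simp, rule red)
  qed (use 3 in auto)
  then show ?case by (simp add: \<Xi>')
next
  case (JoinL \<Gamma>1 a \<Gamma>2 u b)
  from JoinL.prems obtain L X R where \<Xi>': "\<Xi>' = L @ X @ R"
    and r: "replaces V s \<Gamma>1 L" "replaces V s [Join a b] X" "replaces V s \<Gamma>2 R"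
    by (elim replaces_appendE) blast
  have 1: "derives False V (L @ [a] @ R) u" "derives False V (L @ [b] @ R) u"
    by (intro JoinL.IH replaces_append replaces_refl r)+
  note 3 = derives.JoinL[OF 1]
  from r(2) have "derives False V (L @ X @ R) u"
  proof (cases rule: replaces_singleE)
    case 2
    have red: "derives False V (L @ \<Gamma> @ R) u" if "right_premises V \<Gamma> s" for \<Gamma>
    proof (cases "derives False V \<Gamma> a")
      case True
      show ?thesis
        by (rule smaller[of a]) (use True 1 2(1) in auto)
    next
      case False
      then show ?thesis
        by (intro smaller[of b, OF _ _ 1(2)]) (use that 2(1) in auto)
    qed
    from 2(2) show ?thesis
      by (rule cut_right_reduction) (use 3 2(1) in simp, rule red)
  qed (use 3 in auto)
  then show ?case by (simp add: \<Xi>')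
next
  case (MultR \<Gamma>1 a \<Gamma>2 b)
  from MultR.prems show ?case
    by (elim replaces_appendE) (simp, intro derives.MultR MultR.IH)
next
  case (RDivR \<Gamma> a b)
  then show ?case
    by (intro derives.RDivR RDivR.IH replaces_append replaces_refl)
next
  case (LDivR a \<Gamma> b)
  then show ?case
    by (intro derives.LDivR LDivR.IH replaces_append replaces_refl)
next
  case (Weak \<Delta> \<Gamma> \<Theta> u)
  from Weak.prems obtain L X R where \<Xi>': "\<Xi>' = L @ X @ R"
    and r: "replaces V s \<Gamma> L" "replaces V s \<Delta> X" "replaces V s \<Theta> R"
    by (elim replaces_appendE) blast
  \<comment> \<open>Occurrences inside the inserted sequence are not cut at all: the sequence after
    replacement is inserted directly, which \<open>closed\<close> permits.\<close>
  have "V ([] @ X)"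
    using r(2) by (rule replaces_closed) (use Weak.hyps(1) closed in auto)
  then show ?case
    unfolding \<Xi>' by (intro derives.Weak Weak.IH replaces_append r) simp
qed (auto intro: derives.UnitR derives.MeetR derives.JoinR1 derives.JoinR2)

text \<open>The outermost induction is on the size of the cut formula; those on the right and left
  premises sit in \<open>replaces_derives\<close> and \<open>cut_right_reduction\<close>.\<close>

lemma cut_admissible:
  assumes closed: "\<And>\<Delta>1 s \<Delta>2 \<Gamma>. V (\<Delta>1 @ [s] @ \<Delta>2) \<Longrightarrow> derives False V \<Gamma> s \<Longrightarrow> V (\<Delta>1 @ \<Gamma> @ \<Delta>2)"
  shows "derives False V \<Gamma> s \<Longrightarrow> derives False V (L @ [s] @ R) u \<Longrightarrow> derives False V (L @ \<Gamma> @ R) u"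
proof (induction "size s" arbitrary: s \<Gamma> L R u rule: less_induct)
  case less
  have "replaces V s (L @ [s] @ R) (L @ \<Gamma> @ R)"
    using replaces_subst[OF less.prems(1) replaces_Nil]
    by (intro replaces_append replaces_refl) simp
  with less.prems(2) show ?case
    by (rule replaces_derives) (rule less.hyps closed; assumption)+
qed

text \<open>A weakening by \<open>\<Delta>\<close> is a cut of \<open>\<Delta> \<Rightarrow> e\<close> against an instance of \<open>(e\<Rightarrow>)\<close>.\<close>

lemma derives_weak_unit:
  assumes "derives c (\<lambda>\<Delta>. derives True V \<Delta> Unit) \<Gamma> u"
  shows "derives True V \<Gamma> u"
  using assms
proof induction
  case (Weak \<Delta> \<Gamma> \<Theta> u)
  show ?case
    using Weak.hyps(1) by (rule derives.Cut[OF TrueI]) (intro derives.UnitL Weak.IH)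
qed (rule derives.intros; (assumption | rule TrueI))+

lemma cut_elimination:
  assumes "derives True V \<Gamma> u"
  shows "derives False (\<lambda>\<Delta>. derives True V \<Delta> Unit) \<Gamma> u"
proof -
  let ?V = "\<lambda>\<Delta>. derives True V \<Delta> Unit"
  \<comment> \<open>Weakening the axiom \<open>UnitR\<close> by \<open>\<Delta>\<close> shows that
    the enlarged set contains the original one.\<close>
  have V: "?V \<Delta>" if "V \<Delta>" for \<Delta>
    using derives.Weak[of V \<Delta> True "[]" "[]" Unit] that by (simp add: derives.UnitR)
  have cut: "derives False ?V (L @ \<Gamma> @ R) u"
    if "derives False ?V \<Gamma> s" "derives False ?V (L @ [s] @ R) u" for \<Gamma> s L R u
    \<comment> \<open>The placeholder leaves \<open>closed\<close> as a goal: a cut-free derivation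
      from the enlarged set becomes one with cuts from \<open>V\<close>, and one more cut replaces
      the formula inside the inserted sequence.\<close>
    using _ that
    by (rule cut_admissible) (rule derives.Cut[OF TrueI], rule derives_weak_unit)
  from assms show ?thesis
  proof induction
    case (Cut \<Gamma>2 s \<Gamma>1 \<Gamma>3 u)
    from Cut.IH show ?case by (rule cut)
  qed (rule derives.intros; (assumption | rule V, assumption))+
qed

section \<open>Soundness for lattice-ordered groups\<close>

context residuated_lattice
begin

lemma le_refl: "a \<in> carrier A \<Longrightarrow> rl_le A a a"
  unfolding rl_le_def by (metis join_absorb meet_absorb meet_closed)

lemma le_trans:
  "a \<in> carrier A \<Longrightarrow> b \<in> carrier A \<Longrightarrow> c \<in> carrier A \<Longrightarrow> rl_le A a b \<Longrightarrow> rl_le A b c \<Longrightarrow> rl_le A a c"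
  unfolding rl_le_def by (metis meet_assoc)

lemma le_iff_join:
  "a \<in> carrier A \<Longrightarrow> b \<in> carrier A \<Longrightarrow> rl_le A a b \<longleftrightarrow> rl_join A a b = b"
  unfolding rl_le_def by (metis join_absorb join_commute meet_absorb meet_commute)

lemma meet_le1: "a \<in> carrier A \<Longrightarrow> b \<in> carrier A \<Longrightarrow> rl_le A (rl_meet A a b) a"
  unfolding rl_le_def by (metis le_refl meet_assoc meet_commute rl_le_def)

lemma meet_le2: "a \<in> carrier A \<Longrightarrow> b \<in> carrier A \<Longrightarrow> rl_le A (rl_meet A a b) b"
  by (metis meet_le1 meet_commute)

lemma le_meet:
  "a \<in> carrier A \<Longrightarrow> b \<in> carrier A \<Longrightarrow> c \<in> carrier A \<Longrightarrow> rl_le A c a \<Longrightarrow> rl_le A c b \<Longrightarrow>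
    rl_le A c (rl_meet A a b)"
  unfolding rl_le_def by (metis meet_assoc)

lemma le_join1: "a \<in> carrier A \<Longrightarrow> b \<in> carrier A \<Longrightarrow> rl_le A a (rl_join A a b)"
  unfolding rl_le_def by (rule meet_absorb)

lemma le_join2: "a \<in> carrier A \<Longrightarrow> b \<in> carrier A \<Longrightarrow> rl_le A b (rl_join A a b)"
  by (metis le_join1 join_commute)

lemma join_le:
  "a \<in> carrier A \<Longrightarrow> b \<in> carrier A \<Longrightarrow> c \<in> carrier A \<Longrightarrow> rl_le A a c \<Longrightarrow> rl_le A b c \<Longrightarrow>
    rl_le A (rl_join A a b) c"
  by (simp add: le_iff_join join_assoc join_closed)

lemma mult_left_mono:
  assumes "a \<in> carrier A" "b \<in> carrier A" "c \<in> carrier A" "rl_le A a b"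
  shows "rl_le A (c \<otimes>\<^bsub>A\<^esub> a) (c \<otimes>\<^bsub>A\<^esub> b)"
proof -
  have "rl_le A b (rl_ldiv A c (c \<otimes>\<^bsub>A\<^esub> b))"
    using assms by (simp add: ldiv_residual le_refl)
  then have "rl_le A a (rl_ldiv A c (c \<otimes>\<^bsub>A\<^esub> b))"
    using le_trans[OF _ _ _ assms(4)] assms(1-3) by (simp add: ldiv_closed)
  then show ?thesis
    using assms by (simp add: ldiv_residual)
qed

lemma mult_right_mono:
  assumes "a \<in> carrier A" "b \<in> carrier A" "c \<in> carrier A" "rl_le A a b"
  shows "rl_le A (a \<otimes>\<^bsub>A\<^esub> c) (b \<otimes>\<^bsub>A\<^esub> c)"
proof -
  have "rl_le A b (rl_rdiv A (b \<otimes>\<^bsub>A\<^esub> c) c)"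
    using assms by (simp add: rdiv_residual le_refl)
  then have "rl_le A a (rl_rdiv A (b \<otimes>\<^bsub>A\<^esub> c) c)"
    using le_trans[OF _ _ _ assms(4)] assms(1-3) by (simp add: rdiv_closed)
  then show ?thesis
    using assms by (simp add: rdiv_residual)
qed

text \<open>Residuation moves the whole context to the right, so that questions about a factor in
  context become questions about the factor alone.\<close>

lemma mult_le_iff:
  assumes "x \<in> carrier A" "b \<in> carrier A" "z \<in> carrier A" "u \<in> carrier A"
  shows "rl_le A (x \<otimes>\<^bsub>A\<^esub> (b \<otimes>\<^bsub>A\<^esub> z)) u \<longleftrightarrow> rl_le A b (rl_rdiv A (rl_ldiv A x u) z)"
  using assms by (simp add: ldiv_residual rdiv_residual ldiv_closed)

lemma mult_le_mono:
  assumes "x \<in> carrier A" "b \<in> carrier A" "b' \<in> carrier A" "z \<in> carrier A" "u \<in> carrier A"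
    and "rl_le A b b'" "rl_le A (x \<otimes>\<^bsub>A\<^esub> (b' \<otimes>\<^bsub>A\<^esub> z)) u"
  shows "rl_le A (x \<otimes>\<^bsub>A\<^esub> (b \<otimes>\<^bsub>A\<^esub> z)) u"
  using assms le_trans[of b b' "rl_rdiv A (rl_ldiv A x u) z"]
  by (simp add: mult_le_iff ldiv_closed rdiv_closed)

lemma ldiv_mult_le: "a \<in> carrier A \<Longrightarrow> b \<in> carrier A \<Longrightarrow> rl_le A (a \<otimes>\<^bsub>A\<^esub> rl_ldiv A a b) b"
  by (simp flip: ldiv_residual add: ldiv_closed le_refl)

lemma rdiv_mult_le: "a \<in> carrier A \<Longrightarrow> b \<in> carrier A \<Longrightarrow> rl_le A (rl_rdiv A b a \<otimes>\<^bsub>A\<^esub> a) b"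
  by (simp flip: rdiv_residual add: rdiv_closed le_refl)

lemma seq_eval_append:
  assumes "range v \<subseteq> carrier A"
  shows "seq_eval A v (\<Gamma> @ \<Delta>) = seq_eval A v \<Gamma> \<otimes>\<^bsub>A\<^esub> seq_eval A v \<Delta>"
proof -
  note cl = tm_eval_closed[OF residuated_lattice_axioms assms] seq_eval_closed[OF residuated_lattice_axioms assms]
  show ?thesis
  proof (induction \<Gamma>)
    case Nil
    then show ?case using cl by (simp add: seq_eval_def)
  next
    case (Cons s \<Gamma>)
    then show ?case
      using cl(2)[of \<Gamma>] cl(2)[of \<Delta>] cl(1)[of s] by (simp add: seq_eval_def m_assoc)
  qed
qed

end

context l_group
begin

text \<open>Every element has a right inverse, and then right inverses are two-sided: if
  \<open>b\<close> is one of \<open>a\<close> and \<open>c\<close> one of \<open>b\<close>, then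
  \<open>a = a b c = c\<close>.\<close>

lemma ldiv_one_mult:
  assumes "a \<in> carrier A"
  shows "rl_ldiv A a \<one>\<^bsub>A\<^esub> \<otimes>\<^bsub>A\<^esub> a = \<one>\<^bsub>A\<^esub>"
proof -
  let ?b = "rl_ldiv A a \<one>\<^bsub>A\<^esub>"
  let ?c = "rl_ldiv A ?b \<one>\<^bsub>A\<^esub>"
  have cl: "?b \<in> carrier A" "?c \<in> carrier A"
    using assms by (simp_all add: ldiv_closed)
  have "a \<otimes>\<^bsub>A\<^esub> (?b \<otimes>\<^bsub>A\<^esub> ?c) = ?c"
    using assms cl mult_ldiv_one[OF assms] by (simp flip: m_assoc)
  then have "a = ?c"
    using assms cl mult_ldiv_one[OF cl(1)] by simp
  then show ?thesis
    using mult_ldiv_one[OF cl(1)] by simp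
qed

lemma left_cancel_le:
  assumes "a \<in> carrier A" "b \<in> carrier A" "c \<in> carrier A" "rl_le A (c \<otimes>\<^bsub>A\<^esub> a) (c \<otimes>\<^bsub>A\<^esub> b)"
  shows "rl_le A a b"
proof -
  let ?i = "rl_ldiv A c \<one>\<^bsub>A\<^esub>"
  have i: "?i \<in> carrier A"
    using assms(3) by (simp add: ldiv_closed)
  have "rl_le A (?i \<otimes>\<^bsub>A\<^esub> (c \<otimes>\<^bsub>A\<^esub> a)) (?i \<otimes>\<^bsub>A\<^esub> (c \<otimes>\<^bsub>A\<^esub> b))"
    using assms i by (simp add: mult_left_mono)
  moreover have "?i \<otimes>\<^bsub>A\<^esub> (c \<otimes>\<^bsub>A\<^esub> x) = x" if "x \<in> carrier A" for x
    using that assms(3) i by (simp flip: m_assoc add: ldiv_one_mult)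
  ultimately show ?thesis
    using assms(1,2) by simp
qed

lemma right_cancel_le:
  assumes "a \<in> carrier A" "b \<in> carrier A" "c \<in> carrier A" "rl_le A (a \<otimes>\<^bsub>A\<^esub> c) (b \<otimes>\<^bsub>A\<^esub> c)"
  shows "rl_le A a b"
proof -
  let ?i = "rl_ldiv A c \<one>\<^bsub>A\<^esub>"
  have i: "?i \<in> carrier A"
    using assms(3) by (simp add: ldiv_closed)
  have "rl_le A ((a \<otimes>\<^bsub>A\<^esub> c) \<otimes>\<^bsub>A\<^esub> ?i) ((b \<otimes>\<^bsub>A\<^esub> c) \<otimes>\<^bsub>A\<^esub> ?i)"
    using assms i by (simp add: mult_right_mono del: m_assoc)
  moreover have "(x \<otimes>\<^bsub>A\<^esub> c) \<otimes>\<^bsub>A\<^esub> ?i = x" if "x \<in> carrier A" for x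
    using that assms(3) i by (simp add: m_assoc mult_ldiv_one)
  ultimately show ?thesis
    using assms(1,2) by simp
qed

end

lemma rule_sound:
  assumes "rule_instance r Ps S" and "l_group A" and v: "range v \<subseteq> carrier A"
    and prem: "\<forall>P \<in> set Ps. rl_le A (seq_eval A v (antecedent P)) (tm_eval A v (succedent P))"
  shows "rl_le A (seq_eval A v (antecedent S)) (tm_eval A v (succedent S))"
proof -
  interpret l_group A by fact
  have rl: "residuated_lattice A" ..
  let ?T = "tm_eval A v" and ?E = "seq_eval A v"
  note E = seq_eval_append[OF v]
  have T [simp]: "?T t \<in> carrier A" for t
    by (rule tm_eval_closed[OF rl v])
  have Ec [simp]: "?E \<Gamma> \<in> carrier A" for \<Gamma>
    by (rule seq_eval_closed[OF rl v])
  have E1 [simp]: "?E [s] = ?T s" "?E [s, t] = ?T s \<otimes>\<^bsub>A\<^esub> ?T t" "?E [] = \<one>\<^bsub>A\<^esub>" for s t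
    using T by (simp_all add: seq_eval_def)
  \<comment> \<open>Replacing a segment of the antecedent by a smaller one preserves truth; cut,
    weakening and the left rules other than \<open>JoinL\<close> are instances.\<close>
  have sub: "rl_le A (?E (\<Gamma>1 @ \<Delta>' @ \<Gamma>2)) (?T u)"
    if "rl_le A (?E \<Delta>') (?E \<Delta>)" "rl_le A (?E (\<Gamma>1 @ \<Delta> @ \<Gamma>2)) (?T u)" for \<Gamma>1 \<Delta> \<Delta>' \<Gamma>2 u
    using mult_le_mono[of "?E \<Gamma>1" "?E \<Delta>'" "?E \<Delta>" "?E \<Gamma>2" "?T u"] that by (simp add: E)
  from assms(1) show ?thesis
  proof cases
    case (1 s)
    then show ?thesis by (simp add: le_refl)
  next
    case (2 \<Gamma>2 s \<Gamma>1 \<Gamma>3 u)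
    then show ?thesis
      using prem sub[of \<Gamma>2 "[s]" \<Gamma>1 \<Gamma>3 u] by simp
  next
    case (3 \<Gamma>1 \<Gamma>2 u)
    then show ?thesis
      using prem sub[of "[Unit]" "[]" \<Gamma>1 \<Gamma>2 u] by (simp add: le_refl)
  next
    case 4
    then show ?thesis by (simp add: le_refl)
  next
    case (5 \<Gamma>2 s \<Gamma>1 t \<Gamma>3 u)
    have "rl_le A (?T (RDiv t s) \<otimes>\<^bsub>A\<^esub> ?E \<Gamma>2) (?T (RDiv t s) \<otimes>\<^bsub>A\<^esub> ?T s)"
      by (intro mult_left_mono T Ec) (use 5 prem in simp)
    moreover have "rl_le A (?T (RDiv t s) \<otimes>\<^bsub>A\<^esub> ?T s) (?T t)"
      by (simp add: rdiv_mult_le)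
    ultimately have "rl_le A (?T (RDiv t s) \<otimes>\<^bsub>A\<^esub> ?E \<Gamma>2) (?T t)"
      by (rule le_trans[rotated 3]) (simp_all del: tm_eval.simps)
    then have "rl_le A (?E ([RDiv t s] @ \<Gamma>2)) (?E [t])"
      by (simp add: E del: tm_eval.simps append.simps)
    then show ?thesis
      using 5 prem sub[of "[RDiv t s] @ \<Gamma>2" "[t]" \<Gamma>1 \<Gamma>3 u] by simp
  next
    case (6 \<Gamma> s t)
    then show ?thesis
      using prem by (simp add: rdiv_residual E)
  next
    case (7 \<Gamma>2 s \<Gamma>1 t \<Gamma>3 u)
    have "rl_le A (?E \<Gamma>2 \<otimes>\<^bsub>A\<^esub> ?T (LDiv s t)) (?T s \<otimes>\<^bsub>A\<^esub> ?T (LDiv s t))"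
      by (intro mult_right_mono T Ec) (use 7 prem in simp)
    moreover have "rl_le A (?T s \<otimes>\<^bsub>A\<^esub> ?T (LDiv s t)) (?T t)"
      by (simp add: ldiv_mult_le)
    ultimately have "rl_le A (?E \<Gamma>2 \<otimes>\<^bsub>A\<^esub> ?T (LDiv s t)) (?T t)"
      by (rule le_trans[rotated 3]) (simp_all del: tm_eval.simps)
    then have "rl_le A (?E (\<Gamma>2 @ [LDiv s t])) (?E [t])"
      by (simp add: E del: tm_eval.simps)
    then show ?thesis
      using 7 prem sub[of "\<Gamma>2 @ [LDiv s t]" "[t]" \<Gamma>1 \<Gamma>3 u] by simp
  next
    case (8 s \<Gamma> t)
    then show ?thesis
      using prem E[of "[s]" \<Gamma>] by (simp add: ldiv_residual)
  next
    case (9 \<Gamma>1 s t \<Gamma>2 u)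
    then show ?thesis
      using prem sub[of "[Mult s t]" "[s, t]" \<Gamma>1 \<Gamma>2 u] by (simp add: le_refl)
  next
    case (10 \<Gamma>1 s \<Gamma>2 t)
    have "rl_le A (?E \<Gamma>1 \<otimes>\<^bsub>A\<^esub> ?E \<Gamma>2) (?T s \<otimes>\<^bsub>A\<^esub> ?E \<Gamma>2)"
      by (intro mult_right_mono T Ec) (use 10 prem in simp)
    moreover have "rl_le A (?T s \<otimes>\<^bsub>A\<^esub> ?E \<Gamma>2) (?T s \<otimes>\<^bsub>A\<^esub> ?T t)"
      by (intro mult_left_mono T Ec) (use 10 prem in simp)
    ultimately have "rl_le A (?E \<Gamma>1 \<otimes>\<^bsub>A\<^esub> ?E \<Gamma>2) (?T s \<otimes>\<^bsub>A\<^esub> ?T t)"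
      by (rule le_trans[rotated 3]) simp_all
    with 10 show ?thesis by (simp add: E)
  next
    case (11 \<Gamma>1 s \<Gamma>2 u t)
    then show ?thesis
      using prem sub[of "[Meet s t]" "[s]" \<Gamma>1 \<Gamma>2 u] by (simp add: meet_le1)
  next
    case (12 \<Gamma>1 t \<Gamma>2 u s)
    then show ?thesis
      using prem sub[of "[Meet s t]" "[t]" \<Gamma>1 \<Gamma>2 u] by (simp add: meet_le2)
  next
    case (13 \<Gamma> s t)
    then show ?thesis
      using prem by (simp add: le_meet)
  next
    case (14 \<Gamma>1 s \<Gamma>2 u t)
    \<comment> \<open>Distributivity over joins is obtained by residuation: both premises bound
      their active formula by the same residual, which therefore bounds the join.\<close>
    have b: "rl_le A (?T b) (rl_rdiv A (rl_ldiv A (?E \<Gamma>1) (?T u)) (?E \<Gamma>2))" if "b = s \<or> b = t" for b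
    proof -
      have "rl_le A (?E (\<Gamma>1 @ [b] @ \<Gamma>2)) (?T u)"
        using that 14 prem by auto
      then show ?thesis
        by (simp only: E E1 mult_le_iff T Ec)
    qed
    have "rl_le A (rl_join A (?T s) (?T t)) (rl_rdiv A (rl_ldiv A (?E \<Gamma>1) (?T u)) (?E \<Gamma>2))"
      using b by (intro join_le) (simp_all add: rdiv_closed ldiv_closed)
    then have "rl_le A (?T (Join s t)) (rl_rdiv A (rl_ldiv A (?E \<Gamma>1) (?T u)) (?E \<Gamma>2))"
      by simp
    then have "rl_le A (?E (\<Gamma>1 @ [Join s t] @ \<Gamma>2)) (?T u)"
      by (simp only: E E1 mult_le_iff T Ec)
    with 14 show ?thesis by simp
  next
    case (15 \<Gamma> s t)
    then show ?thesis
      using prem le_trans[of "?E \<Gamma>" "?T s" "rl_join A (?T s) (?T t)"]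
      by (simp add: le_join1 join_closed)
  next
    case (16 \<Gamma> t s)
    then show ?thesis
      using prem le_trans[of "?E \<Gamma>" "?T t" "rl_join A (?T s) (?T t)"]
      by (simp add: le_join2 join_closed)
  next
    case (17 \<Delta> \<Gamma> \<Theta> u)
    have "rl_le A (?E \<Delta>) (?E [])"
      using LG_valid_holds_in[OF 17(4) assms(2)] v by (simp add: holds_in_def)
    then show ?thesis
      using 17 prem sub[of \<Delta> "[]" \<Gamma> \<Theta> u] by simp
  qed
qed

lemma derivation_sound: "is_derivation d \<Longrightarrow> LG_valid (conclusion d)"
proof (induction d)
  case (Infer r ds S)
  show ?case
    unfolding LG_valid_def holds_in_def deriv.sel
  proof (intro allI impI)
    fix A :: "nat rl_algebra" and v :: "nat \<Rightarrow> nat"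
    assume A: "l_group A" and v: "range v \<subseteq> carrier A"
    show "rl_le A (seq_eval A v (antecedent S)) (tm_eval A v (succedent S))"
    proof (rule rule_sound[OF _ A v])
      show "rule_instance r (map conclusion ds) S"
        using Infer.prems by simp
      show "\<forall>P \<in> set (map conclusion ds). rl_le A (seq_eval A v (antecedent P)) (tm_eval A v (succedent P))"
      proof
        fix P assume "P \<in> set (map conclusion ds)"
        then have "LG_valid P"
          using Infer by auto
        then show "rl_le A (seq_eval A v (antecedent P)) (tm_eval A v (succedent P))"
          using A v by (simp add: LG_valid_def holds_in_def)
      qed
    qed
  qed
qed

text \<open>An instance of weakening does not determine the inserted sequence, but in a group all
  candidates are conjugate, so that the side condition does not depend on the choice.\<close>

lemma LG_valid_conjugate:
  assumes "LG_valid (\<Delta> \<turnstile> Unit)" and eq: "\<Gamma> @ \<Theta> = \<Gamma>' @ \<Theta>'" "\<Gamma> @ \<Delta> @ \<Theta> = \<Gamma>' @ \<Delta>' @ \<Theta>'"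
  shows "LG_valid (\<Delta>' \<turnstile> Unit)"
  unfolding LG_valid_def holds_in_def
proof (intro allI impI)
  fix A :: "nat rl_algebra" and v :: "nat \<Rightarrow> nat"
  assume A: "l_group A" and v: "range v \<subseteq> carrier A"
  interpret l_group A by fact
  have rl: "residuated_lattice A" ..
  let ?E = "seq_eval A v"
  note E = seq_eval_append[OF v]
  have Ec [simp]: "?E \<Gamma> \<in> carrier A" for \<Gamma>
    by (rule seq_eval_closed[OF rl v])
  have "rl_le A (?E \<Delta>) \<one>\<^bsub>A\<^esub>"
    using assms(1) A v by (simp add: LG_valid_def holds_in_def)
  then have "rl_le A (?E \<Gamma> \<otimes>\<^bsub>A\<^esub> (?E \<Delta> \<otimes>\<^bsub>A\<^esub> ?E \<Theta>)) (?E \<Gamma> \<otimes>\<^bsub>A\<^esub> (\<one>\<^bsub>A\<^esub> \<otimes>\<^bsub>A\<^esub> ?E \<Theta>))"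
    by (intro mult_left_mono mult_right_mono) simp_all
  then have "rl_le A (?E \<Gamma>' \<otimes>\<^bsub>A\<^esub> (?E \<Delta>' \<otimes>\<^bsub>A\<^esub> ?E \<Theta>')) (?E \<Gamma>' \<otimes>\<^bsub>A\<^esub> ?E \<Theta>')"
    using eq[THEN arg_cong[where f = ?E]] by (simp add: E)
  then have "rl_le A (?E \<Delta>' \<otimes>\<^bsub>A\<^esub> ?E \<Theta>') (\<one>\<^bsub>A\<^esub> \<otimes>\<^bsub>A\<^esub> ?E \<Theta>')"
    using left_cancel_le[of "?E \<Delta>' \<otimes>\<^bsub>A\<^esub> ?E \<Theta>'" "?E \<Theta>'" "?E \<Gamma>'"] by simp
  then have "rl_le A (?E \<Delta>') \<one>\<^bsub>A\<^esub>"
    by (rule right_cancel_le[rotated 3]) simp_all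
  then show "rl_le A (?E (antecedent (\<Delta>' \<turnstile> Unit))) (tm_eval A v (succedent (\<Delta>' \<turnstile> Unit)))"
    by simp
qed

section \<open>Derivation trees\<close>

text \<open>The derivation guarantees validity for one reading of each weakening step, and
  \<open>LG_valid_conjugate\<close> extends it to every reading.\<close>

lemma weakens_by_valid: "is_derivation d \<Longrightarrow> weakens_by d \<Delta> \<Longrightarrow> LG_valid (\<Delta> \<turnstile> Unit)"
proof (induction d)
  case (Infer r ds S)
  from Infer.prems(2) consider \<Gamma> \<Theta> u where "r = LGWeak" "map conclusion ds = [\<Gamma> @ \<Theta> \<turnstile> u]"
      "S = (\<Gamma> @ \<Delta> @ \<Theta> \<turnstile> u)"
    | d where "d \<in> set ds" "weakens_by d \<Delta>"
    by auto
  then show ?case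
  proof cases
    case 1
    with Infer.prems(1) have "rule_instance LGWeak [\<Gamma> @ \<Theta> \<turnstile> u] (\<Gamma> @ \<Delta> @ \<Theta> \<turnstile> u)"
      by simp
    then obtain \<Gamma>' \<Delta>' \<Theta>' where "LG_valid (\<Delta>' \<turnstile> Unit)"
      "\<Gamma>' @ \<Theta>' = \<Gamma> @ \<Theta>" "\<Gamma>' @ \<Delta>' @ \<Theta>' = \<Gamma> @ \<Delta> @ \<Theta>"
      by cases auto
    then show ?thesis
      by (rule LG_valid_conjugate)
  next
    case 2
    with Infer show ?thesis by simp
  qed
qed

lemma follows_is_derivation:
  assumes "\<And>\<Delta>. V \<Delta> \<Longrightarrow> LG_valid (\<Delta> \<turnstile> Unit)"
  shows "follows c V d \<Longrightarrow> is_derivation d"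
proof (induction d)
  case (Infer r ds S)
  then have "step c V r (map conclusion ds) S" by simp
  then have "rule_instance r (map conclusion ds) S"
    unfolding step_def
  proof (elim disjE conjE exE)
    fix \<Gamma> \<Delta> \<Theta> u assume "r = LGWeak" "V \<Delta>" "map conclusion ds = [\<Gamma> @ \<Theta> \<turnstile> u]" "S = (\<Gamma> @ \<Delta> @ \<Theta> \<turnstile> u)"
    then show ?thesis
      by (simp only: rule_instance.intros(17)[OF assms])
  qed
  with Infer show ?case by simp
qed

lemma follows_cut_free: "follows False V d \<Longrightarrow> cut_free d"
  by (induction d) (auto simp: step_def)

text \<open>\<open>V\<close> is any set containing all readings, rather than
  \<open>weakens_by d\<close> itself, so that it stays fixed while the induction descends into
  subderivations.\<close>

lemma is_derivation_follows:
  "is_derivation d \<Longrightarrow> (\<And>\<Delta>. weakens_by d \<Delta> \<Longrightarrow> V \<Delta>) \<Longrightarrow> follows True V d"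
proof (induction d)
  case (Infer r ds S)
  have "rule_instance r (map conclusion ds) S"
    using Infer.prems(1) by simp
  then have "step True V r (map conclusion ds) S"
  proof (cases "r = LGWeak")
    case True
    with \<open>rule_instance r (map conclusion ds) S\<close>
    have "rule_instance LGWeak (map conclusion ds) S" by simp
    then obtain \<Gamma> \<Delta> \<Theta> u where *: "map conclusion ds = [\<Gamma> @ \<Theta> \<turnstile> u]" "S = (\<Gamma> @ \<Delta> @ \<Theta> \<turnstile> u)"
      by cases (erule (1) that)
    with True have "weakens_by (Infer r ds S) \<Delta>" by auto
    then have "V \<Delta>" by (rule Infer.prems(2))
    with * True show ?thesis by (auto simp: step_def)
  qed (simp add: step_def)
  moreover have "follows True V d" if "d \<in> set ds" for d
  proof (rule Infer.IH[OF that])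
    show "is_derivation d"
      using that Infer.prems(1) by simp
    show "V \<Delta>" if "weakens_by d \<Delta>" for \<Delta>
      using that \<open>d \<in> set ds\<close> by (intro Infer.prems(2)) auto
  qed
  ultimately show ?case by simp
qed

lemma step_derives:
  assumes "step c V r Ps S" and "\<forall>P \<in> set Ps. derives c V (antecedent P) (succedent P)"
  shows "derives c V (antecedent S) (succedent S)"
proof (cases "r = LGWeak")
  case True
  with assms show ?thesis
    by (auto simp: step_def intro: derives.Weak)
next
  case False
  with assms(1) have "rule_instance r Ps S" and "r \<noteq> LGWeak" "r = Cut \<Longrightarrow> c"
    by (auto simp: step_def)
  then show ?thesis
    using assms(2)
    by cases (simp only: list.set ball_simps simp_thms sequent.sel rule.distinct; (elim conjE)?;
      rule derives.intros; assumption)+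
qed

lemma follows_derives:
  "follows c V d \<Longrightarrow> derives c V (antecedent (conclusion d)) (succedent (conclusion d))"
proof (induction d)
  case (Infer r ds S)
  have "derives c V (antecedent S) (succedent S)"
  proof (rule step_derives)
    show "step c V r (map conclusion ds) S"
      using Infer.prems by simp
  qed (use Infer in auto)
  then show ?case by simp
qed

lemma derivation_exists_step:
  assumes "step c V r Ps S" and "\<forall>P \<in> set Ps. \<exists>d. follows c V d \<and> conclusion d = P"
  shows "\<exists>d. follows c V d \<and> conclusion d = S"
proof -
  from assms(2) obtain f where f: "\<And>P. P \<in> set Ps \<Longrightarrow> follows c V (f P) \<and> conclusion (f P) = P"
    by metis
  then have "map conclusion (map f Ps) = Ps"
    by (simp add: map_idI)
  with f assms(1) show ?thesis
    by (intro exI[of _ "Infer r (map f Ps) S"]) simp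
qed

lemma rule_instance_step:
  "rule_instance r Ps S \<Longrightarrow> r \<noteq> LGWeak \<Longrightarrow> (r = Cut \<Longrightarrow> c) \<Longrightarrow> step c V r Ps S"
  by (simp add: step_def)

lemma derives_derivation: "derives c V \<Gamma> u \<Longrightarrow> \<exists>d. follows c V d \<and> conclusion d = (\<Gamma> \<turnstile> u)"
proof (induction rule: derives.induct)
  case (Weak \<Delta> \<Gamma> \<Theta> u)
  have "step c V LGWeak [\<Gamma> @ \<Theta> \<turnstile> u] (\<Gamma> @ \<Delta> @ \<Theta> \<turnstile> u)"
    using Weak.hyps(1) by (auto simp: step_def)
  then show ?case
    by (rule derivation_exists_step) (use Weak.IH in simp)
qed (rule derivation_exists_step, rule rule_instance_step, rule rule_instance.intros; simp; fail)+

theorem proposition3p2: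
  shows "\<exists>p :: recf. \<forall>d :: deriv. is_derivation d \<longrightarrow>
    (\<exists>d' :: deriv. recf_eval p [deriv_code d] (deriv_code d') \<and>
       is_derivation d' \<and> cut_free d' \<and> conclusion d' = conclusion d)"
proof -
  \<comment> \<open>The enlarged set with derivability expressed by a certificate tree
    \<open>c\<close>, which can be searched for.\<close>
  define V where "V d \<Delta> \<longleftrightarrow> (\<exists>c. conclusion c = (\<Delta> \<turnstile> Unit) \<and> follows True (weakens_by d) c)" for d \<Delta>
  define R where "R z \<longleftrightarrow> conclusion (snd z) = conclusion (fst z) \<and> follows False (V (fst z)) (snd z)"
    for z :: "deriv \<times> deriv"
  have "semidec R"
    unfolding R_def V_def by (rule semidec_conclusion_follows)
  from semi_uniformize[OF this[unfolded semidec_def]] obtain p where p: "\<And>n.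
      \<exists>m. \<exists>z. prod_encode (n, m) = enc z \<and> R z \<Longrightarrow>
      \<exists>m. (\<exists>z. prod_encode (n, m) = enc z \<and> R z) \<and> recf_eval p [n] m"
    by blast
  show ?thesis
  proof (intro exI[of _ p] allI impI)
    fix d assume d: "is_derivation d"
    have V_valid: "LG_valid (\<Delta> \<turnstile> Unit)" if "V d \<Delta>" for \<Delta>
    proof -
      from that obtain c where "conclusion c = (\<Delta> \<turnstile> Unit)" "follows True (weakens_by d) c"
        by (auto simp: V_def)
      then show ?thesis
        using derivation_sound[of c] follows_is_derivation[of "weakens_by d"] weakens_by_valid[OF d]
        by auto
    qed
    have "derives True (weakens_by d) (antecedent (conclusion d)) (succedent (conclusion d))"
      by (intro follows_derives is_derivation_follows d)
    then have "derives False (\<lambda>\<Delta>. derives True (weakens_by d) \<Delta> Unit)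
        (antecedent (conclusion d)) (succedent (conclusion d))"
      by (rule cut_elimination)
    then have "derives False (V d) (antecedent (conclusion d)) (succedent (conclusion d))"
      by (rule derives_mono) (auto simp: V_def dest: derives_derivation)
    \<comment> \<open>This tree only shows that the search succeeds. The program may return another
      one, \<open>snd z\<close> below, about which nothing but \<open>R z\<close> is used.\<close>
    from derives_derivation[OF this] obtain d' where "R (d, d')"
      by (auto simp: R_def)
    then have "prod_encode (deriv_code d, deriv_code d') = enc (d, d') \<and> R (d, d')"
      by simp
    with p[of "deriv_code d"] obtain m z where z: "prod_encode (deriv_code d, m) = enc z" "R z"
      "recf_eval p [deriv_code d] m"
      by blast
    from z(1) have "fst z = d" "m = deriv_code (snd z)"
      by (auto dest: injD[OF inj_deriv_code])
    with z(2,3) have "recf_eval p [deriv_code d] (deriv_code (snd z))"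
      "conclusion (snd z) = conclusion d" "follows False (V d) (snd z)"
      by (auto simp: R_def)
    then show "\<exists>d'. recf_eval p [deriv_code d] (deriv_code d') \<and>
       is_derivation d' \<and> cut_free d' \<and> conclusion d' = conclusion d"
      using follows_is_derivation[of "V d" False] follows_cut_free V_valid by blast
  qed
qed

end
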